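(* Let $H,V,V',\gamma,A,a,f,F,\phi$ be as in the context. Assume that there exist $\alpha\in[0,\tfrac12]$ and $K>0$ such that $\gamma(t)\ge \frac{K}{(1+t)^{\alpha}}$ for every $t\ge 0$. Then for every solution $u$ to the equation $$\frac{d^2u}{dt^2}(t)+\gamma(t)\frac{du}{dt}(t)+Au(t)+f(u(t))=0,\qquad t\ge 0,$$ there exists $u_\infty\in\arg\min\phi$ such that $u(t)$ converges weakly in $V$ to $u_\infty$ as $t\to+\infty$. Moreover, $$\frac12\left|\frac{du}{dt}(t)\right|^2+\phi(u(t))-\min\phi=o\!\left(\frac1t\right)\quad\text{as }t\to+\infty.$$
   Context: $H$ is a real Hilbert space with inner product $\langle\cdot,\cdot\rangle$ and norm $|\cdot|$. $V$ is a real Hilbert space with norm $\|\cdot\|_V$ such that $V\hookrightarrow H\hookrightarrow V'$ with continuous and dense injections, where $V'$ is the dual space of $V$ (so $H$ is identified with its own dual); $\langle\cdot,\cdot\rangle_{V',V}$ denotes the duality pairing. $\gamma:\mathbb{R}^+\to\mathbb{R}^+$ (with $\mathbb{R}^+=[0,+\infty)$) is a decreasing function belonging to $W^{1,1}_{loc}(\mathbb{R}^+;\mathbb{R}^+)$. $A:V\to V'$ is a linear continuous operator such that the bilinear form $a:V\times V\to\mathbb{R}$, $a(u,v)=\langle Au,v\rangle_{V',V}$, is symmetric, positive ($a(v,v)\ge0$ for all $v\in V$), and satisfies: there exist $\lambda\ge0$ and $\mu>0$ such that $a(v,v)+\lambda|v|^2\ge\mu\|v\|_V^2$ for all $v\in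 V$. $f:V\to V'$ is a continuous function deriving from a convex potential: there is a $C^1$ convex function $F:V\to\mathbb{R}$ with $F'(u)(v)=\langle f(u),v\rangle_{V',V}$ for all $u,v\in V$. $\phi:V\to\mathbb{R}$ is defined by $\phi(v)=\frac12a(v,v)+F(v)$. It is assumed that $\phi$ is bounded from below and that the set $\arg\min\phi=\{v\in V:\phi(v)=\min\phi\}$ is nonempty. A solution of the equation is a function $u:\mathbb{R}^+\to H$ belonging to $W^{1,1}_{loc}(\mathbb{R}^+,V)\cap W^{2,1}_{loc}(\mathbb{R}^+,H)$ and satisfying the equation for almost every $t\ge0$. *)

theory Defs
  imports "HOL-Analysis.Analysis" "HOL-Library.Landau_Symbols"
begin

section \<open>Gelfand triples\<close>

text \<open>
  The dual \<open>V'\<close> is the Banach space \<open>'v \<Rightarrow>\<^sub>L real\<close> of bounded linear functionals.  The injection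
  \<open>V \<hookrightarrow> H\<close> is an explicit bounded linear map \<open>J\<close>.  Identifying \<open>H\<close> with its own dual, \<open>h \<in> H\<close> is the
  functional \<open>v \<mapsto> \<langle>h, J v\<rangle>\<close> on \<open>V\<close>.
\<close>

definition dual_embedding ::
  "('v::real_inner \<Rightarrow>\<^sub>L 'h::real_inner) \<Rightarrow> 'h \<Rightarrow> ('v \<Rightarrow>\<^sub>L real)" where
  "dual_embedding J h = blinfun_inner_right h o\<^sub>L J"

lemma dual_embedding_apply [simp]:
  "blinfun_apply (dual_embedding J h) v = inner h (blinfun_apply J v)"
  by (simp add: dual_embedding_def)

definition gelfand_triple :: "('v::real_inner \<Rightarrow>\<^sub>L 'h::real_inner) \<Rightarrow> bool" where
  "gelfand_triple J \<longleftrightarrow>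
     inj (blinfun_apply J) \<and> closure (range (blinfun_apply J)) = UNIV \<and>
     inj (dual_embedding J) \<and> closure (range (dual_embedding J)) = UNIV"


section \<open>Vector-valued Sobolev functions on the half-line\<close>

text \<open>
  The spaces are not assumed separable, whereas the library's Bochner integral is restricted to
  second-countable codomains.  Hence strong measurability (almost everywhere limit of simple
  functions) is spelled out here, and the integral of a Bochner integrable function is taken as its
  Henstock--Kurzweil integral, which coincides with the Bochner integral for such functions.
\<close>

definition strongly_measurable_on :: "real set \<Rightarrow> (real \<Rightarrow> 'a::real_normed_vector) \<Rightarrow> bool" where
  "strongly_measurable_on S g \<longleftrightarrow>
     (\<exists>s. (\<forall>n::nat. simple_function lebesgue (s n)) \<and>
          (AE t in lebesgue. t \<in> S \<longrightarrow> (\<lambda>n. s n t) \<longlonglongrightarrow> g t))"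

text \<open>\<open>L\<^sup>1\<^sub>l\<^sub>o\<^sub>c\<close> on the closed half-line: integrable on every \<open>[0, T]\<close>, including near \<open>0\<close>.\<close>

definition L1_loc :: "(real \<Rightarrow> 'a::real_normed_vector) \<Rightarrow> bool" where
  "L1_loc g \<longleftrightarrow> strongly_measurable_on {0..} g \<and>
     (\<forall>T\<ge>0. set_integrable lebesgue {0..T} (\<lambda>t. norm (g t)))"

text \<open>
  \<open>has_L1_loc_deriv w w'\<close>: the function \<open>w\<close> is the locally absolutely continuous representative of an
  element of \<open>W\<^sup>1\<^sup>,\<^sup>1\<^sub>l\<^sub>o\<^sub>c\<close> whose derivative is \<open>w'\<close>, i.e. \<open>w t = w 0 + \<integral>\<^sub>0\<^sup>t w'\<close>.  The function \<open>w'\<close> is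
  determined by \<open>w\<close> up to null sets on the half-line.
\<close>

definition has_L1_loc_deriv ::
  "(real \<Rightarrow> 'a::real_normed_vector) \<Rightarrow> (real \<Rightarrow> 'a) \<Rightarrow> bool" where
  "has_L1_loc_deriv w w' \<longleftrightarrow>
     L1_loc w' \<and> (\<forall>t\<ge>0. (w' has_integral (w t - w 0)) {0..t})"

definition W11_loc :: "(real \<Rightarrow> 'a::real_normed_vector) \<Rightarrow> bool" where
  "W11_loc w \<longleftrightarrow> (\<exists>w'. has_L1_loc_deriv w w')"


section \<open>The evolution equation\<close>

text \<open>
  A solution takes its values in \<open>V\<close>; as an \<open>H\<close>-valued function it is \<open>\<lambda>t. J (u t)\<close>.  Its first
  derivative \<open>u'\<close> is the locally absolutely continuous representative, its second derivative \<open>u''\<close>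
  is determined almost everywhere.  The equation is an identity in \<open>V'\<close>.
\<close>

definition evolution_solution ::
  "('v::real_inner \<Rightarrow>\<^sub>L 'h::real_inner) \<Rightarrow> (real \<Rightarrow> real) \<Rightarrow> ('v \<Rightarrow>\<^sub>L ('v \<Rightarrow>\<^sub>L real)) \<Rightarrow>
   ('v \<Rightarrow> ('v \<Rightarrow>\<^sub>L real)) \<Rightarrow> (real \<Rightarrow> 'v) \<Rightarrow> bool" where
  "evolution_solution J \<gamma> A f u \<longleftrightarrow>
     W11_loc u \<and>
     (\<exists>u' u''. has_L1_loc_deriv (\<lambda>t. blinfun_apply J (u t)) u' \<and> has_L1_loc_deriv u' u'' \<and>
        (AE t in lebesgue. t \<ge> 0 \<longrightarrow>
           dual_embedding J (u'' t) + \<gamma> t *\<^sub>R dual_embedding J (u' t)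
             + blinfun_apply A (u t) + f (u t) = 0))"


section \<open>Weak convergence and minimisers\<close>

definition weakly_tendsto ::
  "('b \<Rightarrow> 'a::real_normed_vector) \<Rightarrow> 'a \<Rightarrow> 'b filter \<Rightarrow> bool" where
  "weakly_tendsto x l G \<longleftrightarrow>
     (\<forall>\<psi> :: 'a \<Rightarrow>\<^sub>L real. ((\<lambda>t. blinfun_apply \<psi> (x t)) \<longlongrightarrow> blinfun_apply \<psi> l) G)"

definition minimizers :: "('a \<Rightarrow> real) \<Rightarrow> 'a set" where
  "minimizers \<phi> = {v. is_arg_min \<phi> (\<lambda>_. True) v}"

end

theory Submission
  imports Defs "HOL-Real_Asymp.Real_Asymp"
begin

text \<open>
  The proof rests on two differential inequalities. Write \<open>E(t) = |p(t)|\<^sup>2/2 + \<phi>(u(t)) - min \<phi>\<close> with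
  \<open>p\<close> the velocity in \<open>H\<close>. Testing the equation with the velocity gives \<open>E' = -\<gamma> |p|\<^sup>2\<close>
  (\<open>energy_DERIV\<close>). For a minimiser \<open>z\<close> put \<open>h = |u - z|\<^sup>2/2\<close>, so that \<open>h' = k\<close> with \<open>k = \<langle>u - z, p\<rangle>\<close>.
  Testing with \<open>u - z\<close> and using the convexity of \<open>\<phi>\<close> gives \<open>k' \<le> 3/2 |p|\<^sup>2 - \<gamma> k - E\<close>
  (\<open>radial_velocity_slope\<close>). The decay of \<open>E\<close> and the convergence of \<open>h\<close> follow from these two facts. Since
  \<open>\<alpha> \<le> 1/2\<close>, the damping satisfies \<open>\<gamma>(t) \<ge> K / sqrt (1 + t)\<close>.

  Decay of the energy. The function \<open>\<integral>E - t E\<close> has derivative \<open>t \<gamma> |p|\<^sup>2\<close>. As \<open>t \<gamma>(t)\<close> tends to infinity, the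
  term \<open>3/2 |p|\<^sup>2\<close> is eventually at most a small multiple of this derivative. Integrating the second inequality,
  with \<open>\<gamma> h' \<ge> (\<gamma> h)'\<close> because \<open>\<gamma>\<close> decreases, therefore bounds \<open>\<integral>E\<close> by a fraction of itself plus a
  constant; the boundary term \<open>-k - \<gamma> h\<close> is at most \<open>E / \<gamma>\<close>, which is small compared with \<open>t E\<close>. Hence
  \<open>\<integral>E < \<infinity>\<close>, and \<open>t E(t) \<rightarrow> 0\<close> because \<open>E\<close> decreases (\<open>energy_decay\<close>).

  Convergence of the distances. There is a weight \<open>\<theta> = O(sqrt t)\<close> with \<open>\<theta>' = \<gamma> \<theta> - 1\<close>
  (\<open>weight_exists\<close>). With it the first-order terms cancel:
  \<open>(\<theta> k + h)' \<le> 3/2 \<theta> |p|\<^sup>2\<close>, and the right-hand side is at most a constant times the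
  integrable function \<open>t \<gamma> |p|\<^sup>2\<close>; this is where \<open>\<alpha> \<le> 1/2\<close> matters. Since
  \<open>\<theta> |p| \<rightarrow> 0\<close>, the limit of \<open>\<theta> k + h\<close> is also the limit of \<open>h\<close> (\<open>h_converges\<close>).

  Weak convergence. Coercivity, \<open>a(u - z, u - z) \<le> 2 E\<close> and the convergence of \<open>h\<close> bound \<open>u\<close> in \<open>V\<close>.
  Any point of the intersection of the closed convex hulls of the tails of \<open>u\<close> minimises \<open>\<phi>\<close>, because
  \<open>\<phi>(u(t)) \<rightarrow> min \<phi>\<close>. For two such points \<open>x\<close> and \<open>y\<close> the pairing \<open>\<langle>u(t), y - x\<rangle>\<close> converges, being a
  difference of two functions \<open>h\<close> up to a constant. So it takes the same value at \<open>x\<close> and \<open>y\<close>, that is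
  \<open>|y - x|\<^sup>2 = 0\<close>. This is Opial's argument. Weak sequential compactness is replaced by the fact that nested bounded closed
  convex sets in a Hilbert space have a common point (\<open>nested_closed_convex_sets\<close>).

  All identities for the curve are first scalarised by functionals. The chain rule
  \<open>has_L1_loc_deriv_chain\<close> for \<open>C\<^sup>1\<close> functionals along locally absolutely continuous curves then covers both
  tests of the equation.
\<close>

section \<open>Henstock--Kurzweil integrals and null sets\<close>

text \<open>
  The Riemann sums of \<open>|g|\<close> are the sums of the deviations \<open>|content k * g x - \<integral>\<^sub>k g|\<close>, because every
  \<open>\<integral>\<^sub>k g\<close> vanishes. By Henstock's lemma they are small for fine partitions, so \<open>|g|\<close> has integral zero.
\<close>

lemma AE_zero_if_indefinite_integral_zero:
  fixes g :: "real \<Rightarrow> real"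
  assumes g: "\<And>t. t \<ge> 0 \<Longrightarrow> (g has_integral 0) {0..t}"
  shows "AE t in lebesgue. t \<ge> 0 \<longrightarrow> g t = 0"
proof -
  have sub: "integral {s..t} g = 0" if "0 \<le> s" "s \<le> t" for s t
    using Henstock_Kurzweil_Integration.integral_combine[of 0 s t g] g[of s] g[of t] that
    by (auto simp: integral_unique integrable_on_def)
  have zero: "((\<lambda>t. \<bar>g t\<bar>) has_integral 0) {0..T}" if T: "T \<ge> 0" for T
  proof -
    have int: "g integrable_on cbox 0 T" using g[OF T] by auto
    show ?thesis
      unfolding box_real(2)[symmetric] has_integral
    proof (intro allI impI)
      fix e :: real assume e: "e > 0"
      obtain d where d: "gauge d" and
        H: "\<And>p. p tagged_partial_division_of (cbox 0 T) \<Longrightarrow> d fine p \<Longrightarrow>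
             sum (\<lambda>(x,k). norm (measure lborel k *\<^sub>R g x - integral k g)) p < e"
        by (rule Henstock_lemma[OF int e]) blast
      have key: "norm ((\<Sum>(x,k)\<in>p. measure lborel k *\<^sub>R \<bar>g x\<bar>) - 0) < e"
        if p: "p tagged_division_of cbox 0 T" "d fine p" for p
      proof -
        have *: "(\<Sum>(x,k)\<in>p. norm (measure lborel k *\<^sub>R g x - integral k g)) = (\<Sum>(x,k)\<in>p. measure lborel k *\<^sub>R \<bar>g x\<bar>)"
        proof (rule sum.cong[OF refl], clarify)
          fix x k assume xk: "(x, k) \<in> p"
          obtain s t where k: "k = cbox s t" using tagged_division_ofD(4)[OF p(1) xk] by auto
          have "k \<subseteq> cbox 0 T" "x \<in> k" using tagged_division_ofD(2,3)[OF p(1) xk] by auto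
          then have "0 \<le> s" "s \<le> t" using k by auto
          then have "integral k g = 0" using sub k by simp
          then show "norm (measure lborel k *\<^sub>R g x - integral k g) = measure lborel k *\<^sub>R \<bar>g x\<bar>"
            by (simp add: abs_mult)
        qed
        have "p tagged_partial_division_of (cbox 0 T)"
          using p(1) unfolding tagged_division_of_def by (rule conjunct1)
        from H[OF this p(2)] have "(\<Sum>(x,k)\<in>p. measure lborel k *\<^sub>R \<bar>g x\<bar>) < e"
          unfolding * .
        moreover have "0 \<le> (\<Sum>(x,k)\<in>p. measure lborel k *\<^sub>R \<bar>g x\<bar>)"
          by (rule sum_nonneg) (auto simp: case_prod_beta)
        ultimately show ?thesis
          unfolding real_norm_def diff_0_right by (simp only: abs_of_nonneg)
      qed
      show "\<exists>\<gamma>. gauge \<gamma> \<and> (\<forall>\<D>. \<D> tagged_division_of cbox 0 T \<and> \<gamma> fine \<D> \<longrightarrow>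
          norm ((\<Sum>(x, k)\<in>\<D>. measure lborel k *\<^sub>R \<bar>g x\<bar>) - 0) < e)"
        by (intro exI[of _ d] conjI allI impI d, elim conjE, rule key)
    qed
  qed
  have "AE t in lebesgue. t \<in> {0..real n} \<longrightarrow> g t = 0" for n :: nat
  proof -
    let ?f = "\<lambda>t. if t \<in> {0..real n} then \<bar>g t\<bar> else 0"
    have "(?f has_integral 0) UNIV" 
      unfolding has_integral_restrict_UNIV by (rule zero) simp
    then have "?f \<in> borel_measurable lebesgue" "integral\<^sup>N lebesgue ?f = 0"
      using has_integral_iff_nn_integral_lebesgue[of ?f 0] by auto
    then have "AE t in lebesgue. ennreal (?f t) = 0"
      using nn_integral_0_iff_AE[of "\<lambda>t. ennreal (?f t)" lebesgue] by simp
    then show ?thesis by eventually_elim (auto split: if_splits)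
  qed
  then have "AE t in lebesgue. \<forall>n::nat. t \<in> {0..real n} \<longrightarrow> g t = 0"
    unfolding AE_all_countable by blast
  then show ?thesis
  proof eventually_elim
    case (elim t)
    obtain n :: nat where "t \<le> real n" using real_arch_simple by blast
    with elim show ?case by auto
  qed
qed

lemma has_integral_cong_AE_lebesgue:
  fixes f g :: "real \<Rightarrow> 'a::real_normed_vector"
  assumes f: "(f has_integral i) S" and ae: "AE t in lebesgue. t \<in> S \<longrightarrow> g t = f t"
  shows "(g has_integral i) S"
proof -
  obtain N where N: "N \<in> null_sets lebesgue" "{t \<in> space lebesgue. \<not> (t \<in> S \<longrightarrow> g t = f t)} \<subseteq> N"
    using ae unfolding eventually_ae_filter by blast
  show ?thesis
  proof (rule has_integral_spike[OF _ _ f])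
    show "negligible N" using N(1) by (simp add: negligible_iff_null_sets)
    show "g t = f t" if "t \<in> S - N" for t using that N(2) by auto
  qed
qed

lemma has_integral_le_AE_lebesgue:
  fixes f g :: "real \<Rightarrow> real"
  assumes f: "(f has_integral i) S" and g: "(g has_integral j) S"
    and ae: "AE t in lebesgue. t \<in> S \<longrightarrow> f t \<le> g t"
  shows "i \<le> j"
proof (rule has_integral_le[OF f])
  show "((\<lambda>t. max (f t) (g t)) has_integral j) S"
    by (rule has_integral_cong_AE_lebesgue[OF g]) (use ae in \<open>eventually_elim, auto\<close>)
qed simp

section \<open>Locally absolutely continuous curves\<close>

text \<open>
  Measurability is the point. For a simple function \<open>s\<close> the map \<open>t \<mapsto> L t (s t)\<close> is a finite sum of
  continuous functions times indicators, and the simple functions approximating \<open>w\<close> give the general case.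
\<close>

lemma absolutely_integrable_blinfun_apply:
  fixes w :: "real \<Rightarrow> 'a::real_normed_vector" and L :: "real \<Rightarrow> 'a \<Rightarrow>\<^sub>L real"
  assumes w: "L1_loc w" and L: "continuous_on {0..} L" and T: "T \<ge> 0"
  shows "(\<lambda>t. L t (w t)) absolutely_integrable_on {0..T}"
proof -
  obtain s :: "nat \<Rightarrow> real \<Rightarrow> 'a" where s: "\<And>n. simple_function lebesgue (s n)"
    and lim: "AE t in lebesgue. t \<in> {0..} \<longrightarrow> (\<lambda>n. s n t) \<longlonglongrightarrow> w t"
    using w unfolding L1_loc_def strongly_measurable_on_def by metis
  have LT: "continuous_on {0..T} L" using L by (rule continuous_on_subset) auto
  define G where "G n t = (if t \<in> {0..T} then L t (s n t) else 0)" for n t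
  have meas: "G n \<in> borel_measurable lebesgue" for n
  proof -
    have fin: "finite (range (s n))" using simple_functionD(1)[OF s[of n]] by simp
    have "G n t = (\<Sum>y\<in>range (s n). indicator (s n -` {y}) t * (if t \<in> {0..T} then L t y else 0))" for t
      using fin by (simp add: G_def indicator_def if_distrib[where f="\<lambda>x. x * _"] sum.delta' cong: if_cong)
    then have eq: "G n = (\<lambda>t. \<Sum>y\<in>range (s n). indicator (s n -` {y}) t * (if t \<in> {0..T} then L t y else 0))" by auto
    have "(\<lambda>t. if t \<in> {0..T} then L t y else 0) \<in> borel_measurable lebesgue" for y
    proof -
      have "continuous_on {0..T} (\<lambda>t. L t y)" by (intro continuous_intros LT)
      then have "(\<lambda>t. L t y) \<in> borel_measurable (lebesgue_on {0..T})"
        by (intro continuous_imp_measurable_on_sets_lebesgue) auto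
      then show ?thesis by (subst borel_measurable_if) auto
    qed
    moreover have "s n -` {y} \<in> sets lebesgue" for y
      using simple_functionD(2)[OF s[of n], of "{y}"] by simp
    ultimately show ?thesis unfolding eq
      by (intro borel_measurable_sum borel_measurable_times borel_measurable_indicator) auto
  qed
  have "(\<lambda>t. lim (\<lambda>n. G n t)) \<in> borel_measurable lebesgue"
    by (intro borel_measurable_lim_metric meas)
  moreover have "AE t in lebesgue. lim (\<lambda>n. G n t) = (if t \<in> {0..T} then L t (w t) else 0)"
    using lim
  proof eventually_elim
    case (elim t)
    then have "(\<lambda>n. G n t) \<longlonglongrightarrow> (if t \<in> {0..T} then L t (w t) else 0)"
      by (auto simp: G_def intro!: tendsto_intros)
    then show ?case by (rule limI)
  qed
  ultimately have "(\<lambda>t. if t \<in> {0..T} then L t (w t) else 0) \<in> borel_measurable lebesgue"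
    by (rule borel_measurable_AE)
  then have m: "(\<lambda>t. L t (w t)) \<in> borel_measurable (lebesgue_on {0..T})"
    by (subst (asm) borel_measurable_if) auto
  have "compact (L ` {0..T})" by (intro compact_continuous_image LT) auto
  then obtain B where B: "\<And>t. t \<in> {0..T} \<Longrightarrow> norm (L t) \<le> B"
    by (metis bounded_iff compact_imp_bounded imageI)
  have "(\<lambda>t. norm (w t)) integrable_on {0..T}"
    using w T unfolding L1_loc_def using set_lebesgue_integral_eq_integral(1) by blast
  then have i: "(\<lambda>t. B * norm (w t)) integrable_on {0..T}" by (rule integrable_on_mult_right)
  show ?thesis
  proof (rule measurable_bounded_by_integrable_imp_absolutely_integrable[OF m _ i])
    show "norm (L t (w t)) \<le> B * norm (w t)" if "t \<in> {0..T}" for t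
      using B[OF that] norm_blinfun[of "L t" "w t"] by (meson mult_right_mono norm_ge_zero order_trans)
  qed simp
qed

lemma L1_loc_norm_integrable:
  assumes "L1_loc w" "0 \<le> s" "s \<le> t"
  shows "(\<lambda>t. norm (w t)) integrable_on {s..t}"
proof -
  have "(\<lambda>t. norm (w t)) integrable_on {0..t}"
    using assms unfolding L1_loc_def by (meson order_trans set_lebesgue_integral_eq_integral(1))
  then show ?thesis by (rule integrable_subinterval_real) (use assms in auto)
qed

text \<open>
  A functional makes the integrand real-valued, and integrability of real functions passes to subintervals.
\<close>

lemma has_L1_loc_deriv_functional:
  fixes w :: "real \<Rightarrow> 'a::real_normed_vector" and l :: "'a \<Rightarrow>\<^sub>L real"
  assumes w: "has_L1_loc_deriv w w'" and st: "0 \<le> s" "s \<le> t"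
  shows "((\<lambda>r. l (w' r)) has_integral l (w t - w s)) {s..t}"
proof -
  have h: "((\<lambda>r. l (w' r)) has_integral l (w r - w 0)) {0..r}" if "r \<ge> 0" for r
    using has_integral_linear[of w' "w r - w 0" "{0..r}" l] w that
    by (auto simp: has_L1_loc_deriv_def o_def blinfun.bounded_linear_right)
  have hs: "(\<lambda>r. l (w' r)) integrable_on {s..t}"
    using h[of t] st by (auto intro: integrable_subinterval_real[of _ 0 t])
  have "integral {0..s} (\<lambda>r. l (w' r)) + integral {s..t} (\<lambda>r. l (w' r)) = integral {0..t} (\<lambda>r. l (w' r))"
    using h[of t] st by (intro Henstock_Kurzweil_Integration.integral_combine) auto
  then have "integral {s..t} (\<lambda>r. l (w' r)) = l (w t - w s)"
    using h[of s] h[of t] st by (simp add: integral_unique blinfun.diff_right)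
  with hs show ?thesis by (metis integrable_integral)
qed

text \<open>
  Apply the functional \<open>\<langle>w t - w s, \<cdot>\<rangle>\<close> and the Cauchy--Schwarz inequality under the integral.
\<close>

lemma has_L1_loc_deriv_norm_le:
  fixes w :: "real \<Rightarrow> 'a::real_inner"
  assumes w: "has_L1_loc_deriv w w'" and st: "0 \<le> s" "s \<le> t"
  shows "norm (w t - w s) \<le> integral {s..t} (\<lambda>r. norm (w' r))"
proof -
  let ?x = "w t - w s" and ?N = "integral {s..t} (\<lambda>r. norm (w' r))"
  have i: "(\<lambda>r. norm (w' r)) integrable_on {s..t}"
    using w st by (auto simp: has_L1_loc_deriv_def intro: L1_loc_norm_integrable)
  have "((\<lambda>r. inner ?x (w' r)) has_integral inner ?x ?x) {s..t}"
    using has_L1_loc_deriv_functional[OF w st, of "blinfun_inner_right ?x"] by simp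
  moreover have "((\<lambda>r. norm ?x * norm (w' r)) has_integral norm ?x * ?N) {s..t}"
    by (intro has_integral_mult_right integrable_integral i)
  ultimately have "inner ?x ?x \<le> norm ?x * ?N"
    by (rule has_integral_le) (simp add: norm_cauchy_schwarz)
  then have "norm ?x * norm ?x \<le> norm ?x * ?N"
    by (simp add: power2_norm_eq_inner[symmetric] power2_eq_square)
  moreover have "0 \<le> ?N" by (intro integral_nonneg i) auto
  ultimately show ?thesis by (cases "norm ?x = 0") (auto simp: mult_le_cancel_left)
qed

lemma has_L1_loc_deriv_continuous:
  fixes w :: "real \<Rightarrow> 'a::real_inner"
  assumes w: "has_L1_loc_deriv w w'"
  shows "continuous_on {0..} w"
proof -
  define N where "N t = integral {0..t} (\<lambda>r. norm (w' r))" for t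
  have L: "L1_loc w'" using w by (simp add: has_L1_loc_deriv_def)
  have d: "norm (w t - w s) \<le> \<bar>N t - N s\<bar>" if "0 \<le> s" "s \<le> t" for s t
    using Henstock_Kurzweil_Integration.integral_combine[OF that L1_loc_norm_integrable[OF L]] has_L1_loc_deriv_norm_le[OF w that] that
    unfolding N_def by simp
  have d': "norm (w t - w s) \<le> \<bar>N t - N s\<bar>" if "0 \<le> s" "0 \<le> t" for s t
    using d[of s t] d[of t s] that by (cases "s \<le> t") (auto simp: norm_minus_commute abs_minus_commute)
  have N: "continuous_on {0..T} N" if "T \<ge> 0" for T
    unfolding N_def by (intro indefinite_integral_continuous_1 L1_loc_norm_integrable L that order_refl)
  have wT: "continuous_on {0..T} w" if T: "T \<ge> 0" for T
    unfolding continuous_on_iff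
  proof (intro ballI allI impI)
    fix x e :: real assume x: "x \<in> {0..T}" "e > 0"
    then obtain \<delta> where "\<delta> > 0" "\<forall>y\<in>{0..T}. dist y x < \<delta> \<longrightarrow> dist (N y) (N x) < e"
      using N[OF T] unfolding continuous_on_iff by blast
    then show "\<exists>\<delta>>0. \<forall>y\<in>{0..T}. dist y x < \<delta> \<longrightarrow> dist (w y) (w x) < e"
      using d'[of x] x by (intro exI[of _ \<delta>]) (fastforce simp: dist_norm)
  qed
  have "continuous (at x within {0..}) w" if "x \<ge> 0" for x
  proof -
    have "continuous (at x within {0..x+1}) w"
      using wT[of "x+1"] that by (simp add: continuous_on_eq_continuous_within)
    moreover have "at x within {0..x+1} = at x within {0..}"
      by (rule at_within_nhd[of x "{..<x+1}"]) auto
    ultimately show ?thesis by simp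
  qed
  then show ?thesis by (simp add: continuous_on_eq_continuous_within)
qed

text \<open>
  Compactness of \<open>{a..b}\<close> in bisection form: a relation between endpoints that is transitive along the
  interval and holds for all short intervals around each point holds for the whole interval.
\<close>

lemma interval_relation_if_locally:
  fixes R :: "real \<Rightarrow> real \<Rightarrow> bool"
  assumes "a \<le> b"
    and trans: "\<And>r s t. R r s \<Longrightarrow> R s t \<Longrightarrow> a \<le> r \<Longrightarrow> r \<le> s \<Longrightarrow> s \<le> t \<Longrightarrow> t \<le> b \<Longrightarrow> R r t"
    and loc: "\<And>x. a \<le> x \<Longrightarrow> x \<le> b \<Longrightarrow> \<exists>d>0. \<forall>s t. a \<le> s \<and> s \<le> x \<and> x \<le> t \<and> t \<le> b \<and> t - s < d \<longrightarrow> R s t"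
  shows "R a b"
proof -
  have "a \<le> a \<and> b \<le> b \<longrightarrow> R a b"
  proof (rule Bolzano[where P = "\<lambda>s t. a \<le> s \<and> t \<le> b \<longrightarrow> R s t"])
    fix r s t :: real
    assume "a \<le> r \<and> s \<le> b \<longrightarrow> R r s" "a \<le> s \<and> t \<le> b \<longrightarrow> R s t" "r \<le> s" "s \<le> t"
    then show "a \<le> r \<and> t \<le> b \<longrightarrow> R r t" using trans[of r s t] by auto
  next
    fix x assume "a \<le> x" "x \<le> b"
    then obtain d where "d > 0" "\<And>s t. a \<le> s \<Longrightarrow> s \<le> x \<Longrightarrow> x \<le> t \<Longrightarrow> t \<le> b \<Longrightarrow> t - s < d \<Longrightarrow> R s t"
      using loc by blast
    then show "\<exists>d>0. \<forall>s t. s \<le> x \<and> x \<le> t \<and> t - s < d \<longrightarrow> a \<le> s \<and> t \<le> b \<longrightarrow> R s t" by blast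
  qed (rule \<open>a \<le> b\<close>)
  then show ?thesis by simp
qed

text \<open>
  Near a fixed time \<open>x\<close> the functional \<open>\<Phi>\<close> is linear up to an error with small Lipschitz constant \<open>e/2\<close>,
  and for linear functionals the formula is known. The resulting error on a short interval around \<open>x\<close> is
  at most \<open>e\<close> times the integral of \<open>norm w'\<close> there. These errors add up over adjacent intervals, so the
  total error is at most \<open>e * \<integral> norm w'\<close> for every \<open>e > 0\<close>.
\<close>

lemma has_L1_loc_deriv_chain:
  fixes w :: "real \<Rightarrow> 'a::real_inner" and \<Phi> :: "'a \<Rightarrow> real" and \<Phi>' :: "'a \<Rightarrow> 'a \<Rightarrow>\<^sub>L real"
  assumes w: "has_L1_loc_deriv w w'"
    and deriv: "\<And>x. (\<Phi> has_derivative \<Phi>' x) (at x)" and cont: "continuous_on UNIV \<Phi>'"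
    and st: "0 \<le> s" "s \<le> t"
  shows "((\<lambda>r. \<Phi>' (w r) (w' r)) has_integral \<Phi> (w t) - \<Phi> (w s)) {s..t}"
proof -
  define g where "g = (\<lambda>r. \<Phi>' (w r) (w' r))"
  have L: "L1_loc w'" using w by (simp add: has_L1_loc_deriv_def)
  have wc: "continuous_on {0..} w" by (rule has_L1_loc_deriv_continuous[OF w])
  have "continuous_on {0..} (\<lambda>r. \<Phi>' (w r))"
    by (rule continuous_on_compose2[OF cont wc]) auto
  then have "g absolutely_integrable_on {0..T}" if "T \<ge> 0" for T
    unfolding g_def by (rule absolutely_integrable_blinfun_apply[OF L _ that])
  then have "g integrable_on {0..T}" if "T \<ge> 0" for T
    using that set_lebesgue_integral_eq_integral(1) by blast
  then have gi: "g integrable_on {p..q}" if "0 \<le> p" "p \<le> q" for p q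
    using that by (meson atLeastatMost_subset_iff integrable_subinterval_real order_trans order_refl)
  let ?N = "\<lambda>p q. integral {p..q} (\<lambda>r. norm (w' r))"
  have ni: "(\<lambda>r. norm (w' r)) integrable_on {p..q}" if "0 \<le> p" "p \<le> q" for p q
    by (rule L1_loc_norm_integrable[OF L that])
  have est: "\<bar>\<Phi> (w t) - \<Phi> (w s) - integral {s..t} g\<bar> \<le> e * ?N s t" if e: "e > 0" for e
    using st(2)
  proof (rule interval_relation_if_locally)
    fix p q r assume R: "\<bar>\<Phi> (w q) - \<Phi> (w p) - integral {p..q} g\<bar> \<le> e * ?N p q"
       "\<bar>\<Phi> (w r) - \<Phi> (w q) - integral {q..r} g\<bar> \<le> e * ?N q r" and o: "s \<le> p" "p \<le> q" "q \<le> r"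
    have "integral {p..q} g + integral {q..r} g = integral {p..r} g" "?N p q + ?N q r = ?N p r"
      using o st by (auto intro!: Henstock_Kurzweil_Integration.integral_combine gi ni)
    then show "\<bar>\<Phi> (w r) - \<Phi> (w p) - integral {p..r} g\<bar> \<le> e * ?N p r"
      using R by (smt (verit) distrib_left)
  next
    fix x assume x: "s \<le> x" "x \<le> t"
    have "continuous (at (w x)) \<Phi>'" using cont by (simp add: continuous_on_eq_continuous_at)
    then obtain \<rho> where \<rho>: "\<rho> > 0" "\<And>y. dist y (w x) < \<rho> \<Longrightarrow> dist (\<Phi>' y) (\<Phi>' (w x)) < e/2"
      using e unfolding continuous_at_eps_delta by (meson half_gt_zero dist_commute)
    obtain d where d: "d > 0" "\<And>y. y \<ge> 0 \<Longrightarrow> dist y x < d \<Longrightarrow> dist (w y) (w x) < \<rho>"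
      using wc x st \<rho>(1) unfolding continuous_on_iff by (metis atLeast_iff order_trans)
    show "\<exists>d>0. \<forall>p q. s \<le> p \<and> p \<le> x \<and> x \<le> q \<and> q \<le> t \<and> q - p < d \<longrightarrow>
          \<bar>\<Phi> (w q) - \<Phi> (w p) - integral {p..q} g\<bar> \<le> e * ?N p q"
    proof (intro exI[of _ d] conjI allI impI d(1))
      fix p q assume pq: "s \<le> p \<and> p \<le> x \<and> x \<le> q \<and> q \<le> t \<and> q - p < d"
      have near: "dist (w r) (w x) < \<rho>" if "r \<in> {p..q}" for r
        using that pq st by (intro d(2)) (auto simp: dist_real_def)
      \<comment> \<open>near \<open>w x\<close> the map \<open>\<Phi>\<close> differs from the linear map \<open>\<Phi>' (w x)\<close> by a function with
         Lipschitz constant \<open>e/2\<close>\<close>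
      have 1: "\<bar>\<Phi> (w q) - \<Phi> (w p) - \<Phi>' (w x) (w q - w p)\<bar> \<le> e/2 * norm (w q - w p)"
      proof -
        have "norm ((\<Phi> (w q) - \<Phi>' (w x) (w q)) - (\<Phi> (w p) - \<Phi>' (w x) (w p))) \<le> e/2 * norm (w q - w p)"
        proof (rule differentiable_bound[of "ball (w x) \<rho>" "\<lambda>y. \<Phi> y - \<Phi>' (w x) y" "\<lambda>y. blinfun_apply (\<Phi>' y - \<Phi>' (w x))"])
          fix y assume y: "y \<in> ball (w x) \<rho>"
          show "((\<lambda>y. \<Phi> y - \<Phi>' (w x) y) has_derivative blinfun_apply (\<Phi>' y - \<Phi>' (w x))) (at y within ball (w x) \<rho>)"
            unfolding minus_blinfun.rep_eq
            by (intro has_derivative_diff has_derivative_at_withinI[OF deriv] bounded_linear_imp_has_derivative blinfun.bounded_linear_right)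
          show "onorm (blinfun_apply (\<Phi>' y - \<Phi>' (w x))) \<le> e/2"
            using \<rho>(2)[of y] y by (simp add: norm_blinfun.rep_eq[symmetric] dist_norm norm_minus_commute)
        qed (use near[of p] near[of q] pq in \<open>auto simp: dist_commute\<close>)
        then show ?thesis by (simp add: blinfun.diff_right algebra_simps)
      qed
      have 2: "norm (w q - w p) \<le> ?N p q" using pq st by (intro has_L1_loc_deriv_norm_le[OF w]) auto
      have i1: "((\<lambda>r. \<Phi>' (w x) (w' r) - g r) has_integral \<Phi>' (w x) (w q - w p) - integral {p..q} g) {p..q}"
        using pq st by (intro has_integral_diff has_L1_loc_deriv_functional[OF w] integrable_integral gi) auto
      have i2: "((\<lambda>r. e/2 * norm (w' r)) has_integral e/2 * ?N p q) {p..q}"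
        using pq st by (intro has_integral_mult_right integrable_integral ni) auto
      have b: "\<bar>\<Phi>' (w x) (w' r) - g r\<bar> \<le> e/2 * norm (w' r)" if "r \<in> {p..q}" for r
      proof -
        have "norm (\<Phi>' (w x) - \<Phi>' (w r)) \<le> e/2" using \<rho>(2)[OF near[OF that]] by (simp add: dist_norm norm_minus_commute)
        then have "norm ((\<Phi>' (w x) - \<Phi>' (w r)) (w' r)) \<le> e/2 * norm (w' r)"
          by (meson mult_right_mono norm_blinfun norm_ge_zero order_trans)
        then show ?thesis by (simp add: g_def blinfun.diff_left)
      qed
      have "\<Phi>' (w x) (w q - w p) - integral {p..q} g \<le> e/2 * ?N p q"
        by (rule has_integral_le[OF i1 i2]) (metis b abs_le_D1)
      moreover have "- (\<Phi>' (w x) (w q - w p) - integral {p..q} g) \<le> e/2 * ?N p q"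
        by (rule has_integral_le[OF has_integral_neg[OF i1] i2]) (metis b abs_le_D2)
      moreover have "e/2 * norm (w q - w p) \<le> e/2 * ?N p q" using 2 e by simp
      moreover have "e * ?N p q = e/2 * ?N p q + e/2 * ?N p q" by simp
      ultimately show "\<bar>\<Phi> (w q) - \<Phi> (w p) - integral {p..q} g\<bar> \<le> e * ?N p q"
        using 1 by linarith
    qed
  qed
  have "\<bar>\<Phi> (w t) - \<Phi> (w s) - integral {s..t} g\<bar> \<le> 0"
  proof (rule field_le_epsilon)
    fix e :: real assume e: "e > 0"
    have N0: "0 \<le> ?N s t" using st by (intro integral_nonneg ni) auto
    have "e / (?N s t + 1) * ?N s t \<le> e" using e N0 by (simp add: field_simps)
    then show "\<bar>\<Phi> (w t) - \<Phi> (w s) - integral {s..t} g\<bar> \<le> 0 + e"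
      using est[of "e / (?N s t + 1)"] e N0 by auto
  qed
  then have "integral {s..t} g = \<Phi> (w t) - \<Phi> (w s)" by simp
  then show ?thesis using integrable_integral[OF gi[OF st]] by (simp add: g_def)
qed

lemma has_integral_Pair:
  fixes f :: "real \<Rightarrow> 'a::real_normed_vector" and g :: "real \<Rightarrow> 'b::real_normed_vector"
  assumes f: "(f has_integral x) S" and g: "(g has_integral y) S"
  shows "((\<lambda>t. (f t, g t)) has_integral (x, y)) S"
proof -
  have "bounded_linear (\<lambda>a::'a. (a, 0::'b))" "bounded_linear (\<lambda>b::'b. (0::'a, b))"
    by (simp_all add: bounded_linear_Pair bounded_linear_ident bounded_linear_zero)
  from has_integral_add[OF has_integral_linear[OF f this(1)] has_integral_linear[OF g this(2)]]
  show ?thesis by (simp add: o_def)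
qed

lemma L1_loc_Pair:
  fixes f :: "real \<Rightarrow> 'a::real_normed_vector" and g :: "real \<Rightarrow> 'b::real_normed_vector"
  assumes f: "L1_loc f" and g: "L1_loc g"
  shows "L1_loc (\<lambda>t. (f t, g t))"
  unfolding L1_loc_def
proof (intro conjI allI impI)
  show "strongly_measurable_on {0..} (\<lambda>t. (f t, g t))"
  proof -
    obtain s where s: "\<And>n. simple_function lebesgue (s n)" "AE t in lebesgue. t \<in> {0..} \<longrightarrow> (\<lambda>n::nat. s n t) \<longlonglongrightarrow> f t"
      using f unfolding L1_loc_def strongly_measurable_on_def by metis
    obtain r where r: "\<And>n. simple_function lebesgue (r n)" "AE t in lebesgue. t \<in> {0..} \<longrightarrow> (\<lambda>n::nat. r n t) \<longlonglongrightarrow> g t"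
      using g unfolding L1_loc_def strongly_measurable_on_def by metis
    have "AE t in lebesgue. t \<in> {0..} \<longrightarrow> (\<lambda>n. (s n t, r n t)) \<longlonglongrightarrow> (f t, g t)"
      using s(2) r(2) by eventually_elim (auto intro: tendsto_Pair)
    then show ?thesis unfolding strongly_measurable_on_def
      using s(1) r(1) by (intro exI[of _ "\<lambda>n t. (s n t, r n t)"]) auto
  qed
  fix T :: real assume T: "0 \<le> T"
  have i: "(\<lambda>t. norm (f t)) absolutely_integrable_on {0..T}" "(\<lambda>t. norm (g t)) absolutely_integrable_on {0..T}"
    using f g T by (auto simp: L1_loc_def)
  then have m: "(\<lambda>t. norm (f t)) \<in> borel_measurable (lebesgue_on {0..T})" "(\<lambda>t. norm (g t)) \<in> borel_measurable (lebesgue_on {0..T})"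
    by (simp_all add: absolutely_integrable_measurable)
  have "(\<lambda>t. norm (f t) + norm (g t)) integrable_on {0..T}"
    using i by (intro integrable_add set_lebesgue_integral_eq_integral(1))
  then show "(\<lambda>t. norm (f t, g t)) absolutely_integrable_on {0..T}"
    by (rule measurable_bounded_by_integrable_imp_absolutely_integrable[rotated 2])
      (use m in \<open>auto simp: norm_Pair intro!: sqrt_sum_squares_le_sum\<close>)
qed

lemma has_L1_loc_deriv_Pair:
  assumes "has_L1_loc_deriv f f'" "has_L1_loc_deriv g g'"
  shows "has_L1_loc_deriv (\<lambda>t. (f t, g t)) (\<lambda>t. (f' t, g' t))"
  unfolding has_L1_loc_deriv_def
proof (intro conjI allI impI)
  show "L1_loc (\<lambda>t. (f' t, g' t))"
    using assms by (intro L1_loc_Pair) (simp_all add: has_L1_loc_deriv_def)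
  fix t :: real assume "t \<ge> 0"
  then have "((\<lambda>t. (f' t, g' t)) has_integral (f t - f 0, g t - g 0)) {0..t}"
    using assms by (intro has_integral_Pair) (simp_all add: has_L1_loc_deriv_def)
  then show "((\<lambda>t. (f' t, g' t)) has_integral (f t, g t) - (f 0, g 0)) {0..t}" by simp
qed

text \<open>
  A strongly measurable function is almost everywhere a limit of points of one countable set \<open>Y\<close>. Off one
  null set it is orthogonal to all of \<open>Y\<close>, hence to itself.
\<close>

lemma strongly_measurable_AE_zero:
  fixes d :: "real \<Rightarrow> 'a::real_inner"
  assumes d: "strongly_measurable_on {0..} d"
    and int: "\<And>y t. t \<ge> 0 \<Longrightarrow> ((\<lambda>r. inner (d r) y) has_integral 0) {0..t}"
  shows "AE t in lebesgue. t \<ge> 0 \<longrightarrow> d t = 0"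
proof -
  obtain s where s: "\<And>n. simple_function lebesgue (s n)" "AE t in lebesgue. t \<in> {0..} \<longrightarrow> (\<lambda>n::nat. s n t) \<longlonglongrightarrow> d t"
    using d unfolding strongly_measurable_on_def by metis
  define Y where "Y = (\<Union>n. range (s n))"
  have "countable Y" unfolding Y_def
    using simple_functionD(1)[OF s(1)] by (auto intro: countable_finite)
  then have "AE t in lebesgue. \<forall>y\<in>Y. t \<ge> 0 \<longrightarrow> inner (d t) y = 0"
    unfolding AE_ball_countable[OF \<open>countable Y\<close>]
    using AE_zero_if_indefinite_integral_zero[OF int] by blast
  with s(2) show ?thesis
  proof eventually_elim
    case (elim t)
    show ?case
    proof
      assume "t \<ge> 0"
      then have "(\<lambda>n. s n t) \<longlonglongrightarrow> d t" using elim by auto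
      then have "(\<lambda>n. inner (d t) (s n t)) \<longlonglongrightarrow> inner (d t) (d t)" by (rule tendsto_inner[OF tendsto_const])
      moreover have "inner (d t) (s n t) = 0" for n using elim \<open>t \<ge> 0\<close> by (auto simp: Y_def)
      ultimately have "(\<lambda>n::nat. 0) \<longlonglongrightarrow> inner (d t) (d t)" by simp
      from LIMSEQ_unique[OF this tendsto_const] show "d t = 0" by simp
    qed
  qed
qed

text \<open>
  This identifies the derivative of a curve taken in the smaller space with the one taken in the larger
  space; it allows an equation in the dual to be tested with the derivative of the solution.
\<close>

lemma has_L1_loc_deriv_blinfun_unique:
  fixes u :: "real \<Rightarrow> 'a::real_inner" and J :: "'a \<Rightarrow>\<^sub>L 'b::real_inner"
  assumes u: "has_L1_loc_deriv u u'" and p: "has_L1_loc_deriv (\<lambda>t. J (u t)) p"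
  shows "AE t in lebesgue. t \<ge> 0 \<longrightarrow> J (u' t) = p t"
proof -
  let ?d = "\<lambda>t. J (u' t) - p t"
  have "L1_loc (\<lambda>t. (u' t, p t))" using u p by (intro L1_loc_Pair) (simp_all add: has_L1_loc_deriv_def)
  then have "strongly_measurable_on {0..} (\<lambda>t. (u' t, p t))" by (simp add: L1_loc_def)
  then obtain s where s: "\<And>n. simple_function lebesgue (s n)"
    "AE t in lebesgue. t \<in> {0..} \<longrightarrow> (\<lambda>n::nat. s n t) \<longlonglongrightarrow> (u' t, p t)"
    unfolding strongly_measurable_on_def by blast
  have "AE t in lebesgue. t \<ge> 0 \<longrightarrow> ?d t = 0"
  proof (rule strongly_measurable_AE_zero)
    show "strongly_measurable_on {0..} ?d"
      unfolding strongly_measurable_on_def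
    proof (intro exI[of _ "\<lambda>n. (\<lambda>(x, y). J x - y) \<circ> s n"] conjI allI)
      show "AE t in lebesgue. t \<in> {0..} \<longrightarrow> (\<lambda>n. ((\<lambda>(x, y). J x - y) \<circ> s n) t) \<longlonglongrightarrow> J (u' t) - p t"
        using s(2)
      proof eventually_elim
        case (elim t)
        show ?case
        proof
          assume "t \<in> {0..}"
          then have "(\<lambda>n. s n t) \<longlonglongrightarrow> (u' t, p t)" using elim by blast
          from tendsto_fst[OF this] tendsto_snd[OF this]
          have "(\<lambda>n. J (fst (s n t)) - snd (s n t)) \<longlonglongrightarrow> J (u' t) - p t"
            by (intro tendsto_intros) simp_all
          then show "(\<lambda>n. ((\<lambda>(x, y). J x - y) \<circ> s n) t) \<longlonglongrightarrow> J (u' t) - p t"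
            by (simp add: case_prod_beta)
        qed
      qed
    qed (intro simple_function_compose s)
    fix y t assume t: "(0::real) \<le> t"
    have "((\<lambda>r. (blinfun_inner_right y o\<^sub>L J) (u' r) - blinfun_inner_right y (p r)) has_integral
       (blinfun_inner_right y o\<^sub>L J) (u t - u 0) - blinfun_inner_right y (J (u t) - J (u 0))) {0..t}"
      by (intro has_integral_diff has_L1_loc_deriv_functional[OF u] has_L1_loc_deriv_functional[OF p]) (use t in auto)
    then show "((\<lambda>r. inner (?d r) y) has_integral 0) {0..t}"
      by (simp add: inner_diff_left inner_diff_right inner_commute blinfun.diff_right)
  qed
  then show ?thesis by simp
qed

text \<open>
  The fundamental theorem of calculus for a continuous derivative, again by testing with the increment itself.
\<close>

lemma has_L1_loc_deriv_has_vector_derivative: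
  fixes w :: "real \<Rightarrow> 'a::real_inner"
  assumes w: "has_L1_loc_deriv w p" and p: "continuous_on {0..} p" and t: "t > 0"
  shows "(w has_vector_derivative p t) (at t)"
proof -
  have le: "norm (w s - w r - (s - r) *\<^sub>R p t) \<le> e * (s - r)"
    if rs: "0 \<le> r" "r \<le> s" and e: "\<And>x. r \<le> x \<Longrightarrow> x \<le> s \<Longrightarrow> norm (p x - p t) \<le> e" for r s e
  proof -
    let ?x = "w s - w r - (s - r) *\<^sub>R p t"
    have i1: "((\<lambda>y. blinfun_inner_right ?x (p y)) has_integral blinfun_inner_right ?x (w s - w r)) {r..s}"
      by (rule has_L1_loc_deriv_functional[OF w rs])
    have i2: "((\<lambda>_. inner ?x (p t)) has_integral (s - r) *\<^sub>R inner ?x (p t)) {r..s}"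
      using has_integral_const_real[of "inner ?x (p t)" r s] rs by simp
    have i: "((\<lambda>y. inner ?x (p y - p t)) has_integral inner ?x ?x) {r..s}"
      using has_integral_diff[OF i1 i2] by (simp add: inner_diff_right)
    have "((\<lambda>_. norm ?x * e) has_integral (s - r) *\<^sub>R (norm ?x * e)) {r..s}"
      using has_integral_const_real[of "norm ?x * e" r s] rs by simp
    then have "inner ?x ?x \<le> (s - r) *\<^sub>R (norm ?x * e)"
    proof (rule has_integral_le[OF i])
      fix y assume "y \<in> {r..s}"
      then have "norm ?x * norm (p y - p t) \<le> norm ?x * e" using e by (intro mult_left_mono) auto
      with norm_cauchy_schwarz[of ?x "p y - p t"] show "inner ?x (p y - p t) \<le> norm ?x * e" by linarith
    qed
    then have "norm ?x * norm ?x \<le> norm ?x * (e * (s - r))"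
      by (simp add: power2_norm_eq_inner[symmetric] power2_eq_square mult_ac)
    moreover have "0 \<le> e" using e[of r] rs norm_ge_zero[of "p r - p t"] by linarith
    ultimately show ?thesis using rs by (cases "norm ?x = 0") (auto simp: mult_le_cancel_left)
  qed
  show ?thesis
    unfolding has_vector_derivative_def has_derivative_at_alt
  proof (intro conjI allI impI bounded_linear_scaleR_left)
    fix e :: real assume "e > 0"
    then have "\<exists>d>0. \<forall>x\<in>{0..}. dist x t < d \<longrightarrow> dist (p x) (p t) < e"
      using p[unfolded continuous_on_iff, rule_format, of t e] t by simp
    then obtain d where d: "d > 0" "\<And>x. x \<ge> 0 \<Longrightarrow> dist x t < d \<Longrightarrow> dist (p x) (p t) < e"
      by (elim exE conjE) simp
    have "norm (w y - w t - (y - t) *\<^sub>R p t) \<le> e * norm (y - t)" if y: "norm (y - t) < min d t" for y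
    proof (cases "t \<le> y")
      case True
      have "norm (w y - w t - (y - t) *\<^sub>R p t) \<le> e * (y - t)"
        by (rule le) (use True y t d in \<open>auto simp: dist_norm intro!: less_imp_le\<close>)
      then show ?thesis using True by simp
    next
      case False
      have "norm (w t - w y - (t - y) *\<^sub>R p t) \<le> e * (t - y)"
        by (rule le) (use False y t d in \<open>auto simp: dist_norm intro!: less_imp_le\<close>)
      moreover have "w y - w t - (y - t) *\<^sub>R p t = - (w t - w y - (t - y) *\<^sub>R p t)" by (simp add: algebra_simps)
      ultimately show ?thesis using False by (simp only: norm_minus_cancel) simp
    qed
    then show "\<exists>d>0. \<forall>y. norm (y - t) < d \<longrightarrow> norm (w y - w t - (y - t) *\<^sub>R p t) \<le> e * norm (y - t)"
      using d(1) t by (intro exI[of _ "min d t"]) auto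
  qed
qed

section \<open>Upper bounds for difference quotients\<close>

text \<open>
  An upper bound for a one-sided derivative that also makes sense where \<open>D\<close> is not differentiable. The
  difference quotients are taken over intervals that contain \<open>x\<close>; these are what bisection produces, and
  a bound on them everywhere bounds the increments of \<open>D\<close>.
\<close>

definition slope_le :: "(real \<Rightarrow> real) \<Rightarrow> real \<Rightarrow> real \<Rightarrow> bool" where
  "slope_le D c x \<longleftrightarrow>
     (\<forall>e>0. \<exists>d>0. \<forall>s t. s \<le> x \<and> x \<le> t \<and> t - s < d \<longrightarrow> D t - D s \<le> (c + e) * (t - s))"

lemma slope_leI:
  assumes "\<And>e. e > 0 \<Longrightarrow> \<exists>d>0. \<forall>s t. s \<le> x \<and> x \<le> t \<and> t - s < d \<longrightarrow> D t - D s \<le> (c + e) * (t - s)"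
  shows "slope_le D c x"
  using assms unfolding slope_le_def by blast

lemma slope_leE:
  assumes "slope_le D c x" "e > 0"
  obtains d where "d > 0" "\<And>s t. s \<le> x \<Longrightarrow> x \<le> t \<Longrightarrow> t - s < d \<Longrightarrow> D t - D s \<le> (c + e) * (t - s)"
proof -
  obtain d where d: "d > 0" "\<forall>s t. s \<le> x \<and> x \<le> t \<and> t - s < d \<longrightarrow> D t - D s \<le> (c + e) * (t - s)"
    using assms(1)[unfolded slope_le_def, rule_format, OF assms(2)] by (elim exE conjE)
  show ?thesis by (rule that[OF d(1)]) (rule d(2)[rule_format], intro conjI)
qed

lemma DERIV_straddle:
  fixes D :: "real \<Rightarrow> real"
  assumes "(D has_real_derivative c) (at x)" "e > 0"
  obtains d where "d > 0"
    "\<And>s t. s \<le> x \<Longrightarrow> x \<le> t \<Longrightarrow> t - s < d \<Longrightarrow> \<bar>D t - D s - c * (t - s)\<bar> \<le> e * (t - s)"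
proof -
  obtain d where d: "d > 0" "\<And>y. norm (y - x) < d \<Longrightarrow> norm (D y - D x - c * (y - x)) \<le> e * norm (y - x)"
    using assms unfolding has_field_derivative_def has_derivative_at_alt by blast
  show ?thesis
  proof (rule that[OF d(1)])
    fix s t assume st: "s \<le> x" "x \<le> t" "t - s < d"
    have "\<bar>D t - D x - c * (t - x)\<bar> \<le> e * (t - x)" "\<bar>D s - D x - c * (s - x)\<bar> \<le> e * (x - s)"
      using d(2)[of t] d(2)[of s] st by auto
    then show "\<bar>D t - D s - c * (t - s)\<bar> \<le> e * (t - s)" by (simp add: abs_le_iff algebra_simps)
  qed
qed

lemma slope_le_DERIV:
  assumes "(D has_real_derivative c) (at x)"
  shows "slope_le D c x"
proof (rule slope_leI)
  fix e :: real assume "e > 0"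
  with assms obtain d where "d > 0" and d:
    "\<And>s t. s \<le> x \<Longrightarrow> x \<le> t \<Longrightarrow> t - s < d \<Longrightarrow> \<bar>D t - D s - c * (t - s)\<bar> \<le> e * (t - s)"
    by (rule DERIV_straddle) blast
  have "D t - D s \<le> (c + e) * (t - s)" if "s \<le> x \<and> x \<le> t \<and> t - s < d" for s t
  proof -
    have "\<bar>D t - D s - c * (t - s)\<bar> \<le> e * (t - s)" using that by (intro d) auto
    then show ?thesis unfolding distrib_right by linarith
  qed
  then show "\<exists>d>0. \<forall>s t. s \<le> x \<and> x \<le> t \<and> t - s < d \<longrightarrow> D t - D s \<le> (c + e) * (t - s)"
    using \<open>d > 0\<close> by blast
qed

lemma slope_le_mono:
  assumes "slope_le D c x" "c \<le> c'"
  shows "slope_le D c' x"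
proof (rule slope_leI)
  fix e :: real assume "e > 0"
  with assms(1) obtain d where d: "d > 0"
    "\<And>s t. s \<le> x \<Longrightarrow> x \<le> t \<Longrightarrow> t - s < d \<Longrightarrow> D t - D s \<le> (c + e) * (t - s)"
    by (rule slope_leE) blast
  have "D t - D s \<le> (c' + e) * (t - s)" if "s \<le> x \<and> x \<le> t \<and> t - s < d" for s t
  proof -
    have "(c + e) * (t - s) \<le> (c' + e) * (t - s)" using that assms(2) by (intro mult_right_mono) auto
    with d(2)[of s t] that show ?thesis by linarith
  qed
  then show "\<exists>d>0. \<forall>s t. s \<le> x \<and> x \<le> t \<and> t - s < d \<longrightarrow> D t - D s \<le> (c' + e) * (t - s)"
    using d(1) by blast
qed

lemma slope_le_add:
  assumes "slope_le D c x" "slope_le E b x"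
  shows "slope_le (\<lambda>t. D t + E t) (c + b) x"
proof (rule slope_leI)
  fix e :: real assume "e > 0"
  then have e: "e/2 > 0" by simp
  obtain d1 where d1: "d1 > 0"
    "\<And>s t. s \<le> x \<Longrightarrow> x \<le> t \<Longrightarrow> t - s < d1 \<Longrightarrow> D t - D s \<le> (c + e/2) * (t - s)"
    by (rule slope_leE[OF assms(1) e]) blast
  obtain d2 where d2: "d2 > 0"
    "\<And>s t. s \<le> x \<Longrightarrow> x \<le> t \<Longrightarrow> t - s < d2 \<Longrightarrow> E t - E s \<le> (b + e/2) * (t - s)"
    by (rule slope_leE[OF assms(2) e]) blast
  have "D t + E t - (D s + E s) \<le> (c + b + e) * (t - s)" if "s \<le> x \<and> x \<le> t \<and> t - s < min d1 d2" for s t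
  proof -
    have "(c + b + e) * (t - s) = (c + e/2) * (t - s) + (b + e/2) * (t - s)" by (simp add: algebra_simps)
    with d1(2)[of s t] d2(2)[of s t] that show ?thesis by linarith
  qed
  then show "\<exists>d>0. \<forall>s t. s \<le> x \<and> x \<le> t \<and> t - s < d \<longrightarrow> D t + E t - (D s + E s) \<le> (c + b + e) * (t - s)"
    using d1(1) d2(1) by (intro exI[of _ "min d1 d2"] conjI allI impI) (simp, blast)
qed

text \<open>
  The product rule needs a nonnegative differentiable weight: it may be multiplied into an inequality for
  \<open>k\<close>, while the term with the derivative of the weight is an equality.
\<close>

lemma slope_le_mult:
  fixes \<theta> k :: "real \<Rightarrow> real"
  assumes \<theta>: "(\<theta> has_real_derivative b) (at x)" and pos: "\<forall>\<^sub>F t in nhds x. 0 \<le> \<theta> t"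
    and k: "slope_le k c x" "isCont k x"
  shows "slope_le (\<lambda>t. \<theta> t * k t) (b * k x + \<theta> x * c) x"
proof (rule slope_leI)
  fix e :: real assume e: "e > 0"
  have \<theta>x: "\<theta> x \<ge> 0" by (rule eventually_nhds_x_imp_x[OF pos])
  define M where "M = \<bar>c\<bar> + \<theta> x + 1 + \<bar>b\<bar> + \<bar>k x\<bar> + 1"
  define \<epsilon> where "\<epsilon> = min 1 (e / M)"
  have M: "M > 0" unfolding M_def using \<theta>x by linarith
  then have \<epsilon>: "\<epsilon> > 0" "\<epsilon> \<le> 1" "\<epsilon> * M \<le> e" using e unfolding \<epsilon>_def
    by (simp_all add: min_le_iff_disj pos_le_divide_eq[symmetric])
  obtain d1 where d1: "d1 > 0"
    "\<And>s t. s \<le> x \<Longrightarrow> x \<le> t \<Longrightarrow> t - s < d1 \<Longrightarrow> \<bar>\<theta> t - \<theta> s - b * (t - s)\<bar> \<le> \<epsilon> * (t - s)"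
    by (rule DERIV_straddle[OF \<theta> \<epsilon>(1)]) blast
  obtain d2 where d2: "d2 > 0"
    "\<And>s t. s \<le> x \<Longrightarrow> x \<le> t \<Longrightarrow> t - s < d2 \<Longrightarrow> k t - k s \<le> (c + \<epsilon>) * (t - s)"
    by (rule slope_leE[OF k(1) \<epsilon>(1)]) blast
  have near: "\<forall>\<^sub>F t in nhds x. \<bar>g t - g x\<bar> < \<epsilon>" if "isCont g x" for g :: "real \<Rightarrow> real"
  proof -
    have "(g \<longlongrightarrow> g x) (nhds x)" using that by (simp only: isCont_def tendsto_at_iff_tendsto_nhds)
    from tendstoD[OF this \<epsilon>(1)] show ?thesis by (simp add: dist_real_def)
  qed
  from pos near[OF DERIV_isCont[OF \<theta>]] near[OF k(2)] have "\<forall>\<^sub>F t in nhds x. 0 \<le> \<theta> t \<and> \<bar>\<theta> t - \<theta> x\<bar> < \<epsilon> \<and> \<bar>k t - k x\<bar> < \<epsilon>"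
    by (auto simp: eventually_conj_iff)
  then obtain d3 where d3: "d3 > 0" "\<And>t. dist t x < d3 \<Longrightarrow> 0 \<le> \<theta> t \<and> \<bar>\<theta> t - \<theta> x\<bar> < \<epsilon> \<and> \<bar>k t - k x\<bar> < \<epsilon>"
    unfolding eventually_nhds_metric by blast
  have "\<theta> t * k t - \<theta> s * k s \<le> (b * k x + \<theta> x * c + e) * (t - s)"
    if st: "s \<le> x \<and> x \<le> t \<and> t - s < min d1 (min d2 d3)" for s t
  proof -
    have ts: "t - s \<ge> 0" using st by simp
    have near: "0 \<le> \<theta> t" "\<bar>\<theta> t - \<theta> x\<bar> < \<epsilon>" "\<bar>k s - k x\<bar> < \<epsilon>"
      using d3(2)[of t] d3(2)[of s] st by (auto simp: dist_real_def)
    define \<rho> where "\<rho> = \<theta> t - \<theta> s - b * (t - s)"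
    have \<rho>: "\<bar>\<rho>\<bar> \<le> \<epsilon> * (t - s)" using d1(2)[of s t] st by (simp add: \<rho>_def)
    have "\<rho> * k s \<le> \<bar>\<rho>\<bar> * \<bar>k s\<bar>" by (metis abs_ge_self abs_mult)
    also have "\<dots> \<le> \<epsilon> * (t - s) * (\<bar>k x\<bar> + 1)" using \<rho> near \<epsilon> by (intro mult_mono) auto
    finally have 1: "\<rho> * k s \<le> \<epsilon> * (\<bar>k x\<bar> + 1) * (t - s)" by (simp add: algebra_simps)
    have "\<theta> t * (k t - k s) \<le> \<theta> t * ((c + \<epsilon>) * (t - s))"
      using d2(2)[of s t] st near(1) by (intro mult_left_mono) auto
    moreover have "\<theta> t * (c + \<epsilon>) \<le> \<theta> x * c + \<epsilon> * (\<bar>c\<bar> + \<theta> x + 1)"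
    proof -
      have "(\<theta> t - \<theta> x) * c \<le> \<bar>\<theta> t - \<theta> x\<bar> * \<bar>c\<bar>" by (metis abs_ge_self abs_mult)
      also have "\<dots> \<le> \<epsilon> * \<bar>c\<bar>" using near by (intro mult_right_mono) auto
      finally have "(\<theta> t - \<theta> x) * c \<le> \<epsilon> * \<bar>c\<bar>" .
      moreover have "\<theta> t * \<epsilon> \<le> (\<theta> x + 1) * \<epsilon>" using near \<epsilon> by (intro mult_right_mono) auto
      ultimately show ?thesis by (simp add: algebra_simps)
    qed
    ultimately have 2: "\<theta> t * (k t - k s) \<le> (\<theta> x * c + \<epsilon> * (\<bar>c\<bar> + \<theta> x + 1)) * (t - s)"
      using mult_right_mono[OF _ ts] by (smt (verit) mult.assoc)
    have "b * k s \<le> b * k x + \<epsilon> * \<bar>b\<bar>"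
    proof -
      have "b * (k s - k x) \<le> \<bar>b\<bar> * \<bar>k s - k x\<bar>" by (metis abs_ge_self abs_mult)
      also have "\<dots> \<le> \<bar>b\<bar> * \<epsilon>" using near by (intro mult_left_mono) auto
      finally show ?thesis by (simp add: algebra_simps)
    qed
    then have 3: "b * k s * (t - s) \<le> (b * k x + \<epsilon> * \<bar>b\<bar>) * (t - s)" using ts by (rule mult_right_mono)
    have "\<theta> t * k t - \<theta> s * k s = \<theta> t * (k t - k s) + b * k s * (t - s) + \<rho> * k s"
      by (simp add: \<rho>_def algebra_simps)
    also have "\<dots> \<le> (b * k x + \<theta> x * c + \<epsilon> * M) * (t - s)"
      using 1 2 3 unfolding M_def by (simp add: algebra_simps)
    also have "\<dots> \<le> (b * k x + \<theta> x * c + e) * (t - s)" using \<epsilon> ts by (intro mult_right_mono) auto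
    finally show ?thesis .
  qed
  then show "\<exists>d>0. \<forall>s t. s \<le> x \<and> x \<le> t \<and> t - s < d \<longrightarrow>
      \<theta> t * k t - \<theta> s * k s \<le> (b * k x + \<theta> x * c + e) * (t - s)"
    using d1(1) d2(1) d3(1) by (intro exI[of _ "min d1 (min d2 d3)"] conjI allI impI) (simp, blast)
qed

lemma slope_le_antimono:
  assumes "\<And>s t. a \<le> s \<Longrightarrow> s \<le> t \<Longrightarrow> g t \<le> g s" "a < x"
  shows "slope_le g 0 x"
proof (rule slope_leI)
  fix e :: real assume e: "e > 0"
  have "g t - g s \<le> (0 + e) * (t - s)" if "s \<le> x \<and> x \<le> t \<and> t - s < x - a" for s t
  proof -
    have "g t \<le> g s" using that assms by auto
    moreover have "0 \<le> e * (t - s)" using e that by simp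
    ultimately show ?thesis by simp
  qed
  then show "\<exists>d>0. \<forall>s t. s \<le> x \<and> x \<le> t \<and> t - s < d \<longrightarrow> g t - g s \<le> (0 + e) * (t - s)"
    using assms(2) by (intro exI[of _ "x - a"] conjI allI impI) (simp, blast)
qed

lemma slope_le_integral:
  fixes R :: "real \<Rightarrow> real"
  assumes R: "continuous_on {a..} R" and le: "\<And>s t. a \<le> s \<Longrightarrow> s \<le> t \<Longrightarrow> k t - k s \<le> integral {s..t} R"
    and x: "a < x"
  shows "slope_le k (R x) x"
proof (rule slope_leI)
  fix e :: real assume "e > 0"
  then obtain d where d: "d > 0" "\<And>y. y \<ge> a \<Longrightarrow> dist y x < d \<Longrightarrow> dist (R y) (R x) < e"
    using R x unfolding continuous_on_iff by (metis atLeast_iff less_imp_le)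
  have "k t - k s \<le> (R x + e) * (t - s)" if st: "s \<le> x \<and> x \<le> t \<and> t - s < min d (x - a)" for s t
  proof -
    have "integral {s..t} R \<le> integral {s..t} (\<lambda>_. R x + e)"
    proof (rule integral_le)
      show "R integrable_on {s..t}"
        by (rule integrable_continuous_real, rule continuous_on_subset[OF R]) (use st in auto)
      fix y assume "y \<in> {s..t}"
      then have "dist (R y) (R x) < e" using st by (intro d(2)) (auto simp: dist_real_def)
      then show "R y \<le> R x + e" by (simp add: dist_real_def)
    qed (rule integrable_const_ivl)
    then show ?thesis using le[of s t] st by (simp add: mult.commute)
  qed
  then show "\<exists>d>0. \<forall>s t. s \<le> x \<and> x \<le> t \<and> t - s < d \<longrightarrow> k t - k s \<le> (R x + e) * (t - s)"
    using d(1) x by (intro exI[of _ "min d (x - a)"] conjI allI impI) (simp, blast)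
qed

text \<open>
  Bisection with an arbitrarily small slope \<open>e\<close> in place of \<open>0\<close>.
\<close>

lemma slope_le_zero_imp_antimono:
  assumes "a \<le> b" and D: "\<And>x. a \<le> x \<Longrightarrow> x \<le> b \<Longrightarrow> slope_le D 0 x"
  shows "D b \<le> D a"
proof -
  have "D b - D a \<le> e * (b - a)" if e: "e > 0" for e
    using \<open>a \<le> b\<close>
  proof (rule Bolzano[where P = "\<lambda>s t. D t - D s \<le> e * (t - s)"])
    fix r s t assume "D s - D r \<le> e * (s - r)" "D t - D s \<le> e * (t - s)"
    then show "D t - D r \<le> e * (t - r)" by (simp add: algebra_simps)
  next
    fix x assume "a \<le> x" "x \<le> b"
    then show "\<exists>d>0. \<forall>s t. s \<le> x \<and> x \<le> t \<and> t - s < d \<longrightarrow> D t - D s \<le> e * (t - s)"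
      using D[of x] e unfolding slope_le_def by simp
  qed
  have "D b - D a \<le> 0"
  proof (rule field_le_epsilon)
    fix e :: real assume e: "e > 0"
    have "e / (b - a + 1) * (b - a) \<le> e" using e \<open>a \<le> b\<close> by (simp add: field_simps)
    moreover have "e / (b - a + 1) > 0" using e \<open>a \<le> b\<close> by simp
    ultimately show "D b - D a \<le> 0 + e"
      using \<open>\<And>e. e > 0 \<Longrightarrow> D b - D a \<le> e * (b - a)\<close>[of "e / (b - a + 1)"] by simp
  qed
  then show ?thesis by simp
qed

lemma tendsto_at_top_antimono:
  fixes g :: "real \<Rightarrow> real"
  assumes anti: "\<And>s t. a \<le> s \<Longrightarrow> s \<le> t \<Longrightarrow> g t \<le> g s" and low: "\<And>t. a \<le> t \<Longrightarrow> m \<le> g t"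
  shows "\<exists>l. (g \<longlongrightarrow> l) at_top"
proof -
  have bdd: "bdd_below (g ` {a..})" by (rule bdd_belowI2[of _ m]) (use low in auto)
  have "(g \<longlongrightarrow> Inf (g ` {a..})) at_top"
  proof (rule order_tendstoI)
    fix y assume "y < Inf (g ` {a..})"
    then have "y < g t" if "t \<ge> a" for t using cInf_lower[OF _ bdd, of "g t"] that by fastforce
    then show "\<forall>\<^sub>F t in at_top. y < g t" using eventually_at_top_linorder by blast
  next
    fix y assume "Inf (g ` {a..}) < y"
    then obtain s where s: "s \<ge> a" "g s < y" using cInf_lessD[of "g ` {a..}" y] by auto
    then have "g t < y" if "t \<ge> s" for t using anti[OF s(1) that] by simp
    then show "\<forall>\<^sub>F t in at_top. g t < y" using eventually_at_top_linorder by blast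
  qed
  then show ?thesis by blast
qed

lemma tendsto_at_top_mono:
  fixes g :: "real \<Rightarrow> real"
  assumes "\<And>s t. 1 < s \<Longrightarrow> s \<le> t \<Longrightarrow> g s \<le> g t" "\<And>t. t > 1 \<Longrightarrow> g t \<le> M"
  shows "\<exists>l. (g \<longlongrightarrow> l) at_top"
proof -
  have "\<exists>l. ((\<lambda>t. - g t) \<longlongrightarrow> l) at_top"
    by (rule tendsto_at_top_antimono[of 2 _ "- M"]) (use assms in auto)
  then show ?thesis using tendsto_minus by fastforce
qed

lemma eventually_nhds_nonneg:
  fixes g :: "real \<Rightarrow> real"
  assumes "t > 0" "\<And>s. s > 0 \<Longrightarrow> 0 \<le> g s"
  shows "\<forall>\<^sub>F s in nhds t. 0 \<le> g s"
  by (rule eventually_mono[OF eventually_nhds_in_open[of "{0<..}"]]) (use assms in auto)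

lemma integral_DERIV:
  fixes g :: "real \<Rightarrow> real"
  assumes g: "continuous_on {a..} g" and t: "a < t"
  shows "((\<lambda>t. integral {a..t} g) has_real_derivative g t) (at t)"
proof -
  have "continuous_on {a..t+1} g" by (rule continuous_on_subset[OF g]) auto
  then have "((\<lambda>t. integral {a..t} g) has_real_derivative g t) (at t within {a..t+1})"
    by (rule integral_has_real_derivative) (use t in auto)
  moreover have "at t within {a..t+1} = at t" by (rule at_within_interior) (use t in auto)
  ultimately show ?thesis by simp
qed

lemma has_integral_imp_DERIV:
  fixes D g :: "real \<Rightarrow> real"
  assumes g: "continuous_on {0..} g" and int: "\<And>t. t \<ge> 0 \<Longrightarrow> (g has_integral D t - D 0) {0..t}" and t: "t > 0"
  shows "(D has_real_derivative g t) (at t)"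
proof -
  have "((\<lambda>t. D 0 + integral {0..t} g) has_real_derivative 0 + g t) (at t)"
    by (intro DERIV_add DERIV_const integral_DERIV[OF g t])
  then have "((\<lambda>t. D 0 + integral {0..t} g) has_real_derivative g t) (at t)" by simp
  then show ?thesis
  proof (rule has_field_derivative_transform_within_open[of _ _ _ "{0<..}"])
    show "D 0 + integral {0..s} g = D s" if "s \<in> {0<..}" for s
      using int[of s] that by (simp add: integral_unique)
  qed (use t in auto)
qed

section \<open>The scalar differential inequalities\<close>

text \<open>
  The quantities that remain of the evolution: the damping \<open>\<gamma>\<close>, the energy \<open>E\<close>, the squared speed \<open>q\<close>, half
  the squared distance \<open>h\<close> to a minimiser, and its derivative \<open>k\<close>. Along a solution, \<open>k\<close> is only absolutely
  continuous, so the second-order inequality is expressed by \<open>slope_le\<close>.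
\<close>

locale scalar_dynamics =
  fixes K :: real and \<gamma> E q h k :: "real \<Rightarrow> real"
  assumes K: "K > 0"
    and \<gamma>_cont: "continuous_on {0..} \<gamma>"
    and \<gamma>_antimono: "\<And>s t. 0 \<le> s \<Longrightarrow> s \<le> t \<Longrightarrow> \<gamma> t \<le> \<gamma> s"
    and \<gamma>_ge: "\<And>t. t \<ge> 0 \<Longrightarrow> K / sqrt (1 + t) \<le> \<gamma> t"
    and E_nonneg: "\<And>t. t > 0 \<Longrightarrow> 0 \<le> E t"
    and E_DERIV: "\<And>t. t > 0 \<Longrightarrow> (E has_real_derivative - \<gamma> t * q t) (at t)"
    and q_nonneg: "\<And>t. t > 0 \<Longrightarrow> 0 \<le> q t"
    and q_le: "\<And>t. t > 0 \<Longrightarrow> q t \<le> 2 * E t"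
    and h_nonneg: "\<And>t. t > 0 \<Longrightarrow> 0 \<le> h t"
    and h_DERIV: "\<And>t. t > 0 \<Longrightarrow> (h has_real_derivative k t) (at t)"
    and k_sq: "\<And>t. t > 0 \<Longrightarrow> (k t)\<^sup>2 \<le> 2 * h t * q t"
    and k_cont: "\<And>t. t > 0 \<Longrightarrow> isCont k t"
    and k_slope: "\<And>t. t > 0 \<Longrightarrow> slope_le k (3/2 * q t - \<gamma> t * k t - E t) t"
begin

definition cumulated_energy :: "real \<Rightarrow> real" where "cumulated_energy t = integral {1..t} E"

text \<open>
  Up to a constant, this is the integral of \<open>t \<gamma> q\<close>; see \<open>weighted_dissipation_DERIV\<close>. In this form it is
  visibly bounded by the cumulated energy.
\<close>

definition weighted_dissipation :: "real \<Rightarrow> real" where "weighted_dissipation t = cumulated_energy t - t * E t"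

lemma \<gamma>_pos: "t \<ge> 0 \<Longrightarrow> \<gamma> t > 0"
  using \<gamma>_ge[of t] K by (smt (verit) divide_pos_pos real_sqrt_gt_zero)

lemma \<gamma>_nonneg: "t \<ge> 0 \<Longrightarrow> \<gamma> t \<ge> 0"
  using \<gamma>_pos by (simp add: less_imp_le)

lemma E_antimono: "0 < s \<Longrightarrow> s \<le> t \<Longrightarrow> E t \<le> E s"
  by (rule deriv_nonpos_imp_antimono[of s t E "\<lambda>t. - \<gamma> t * q t"])
    (use E_DERIV \<gamma>_nonneg q_nonneg in \<open>auto intro!: mult_nonneg_nonneg\<close>)

lemma t_\<gamma>_ge: "t \<ge> 1 \<Longrightarrow> K / 2 * sqrt (1 + t) \<le> t * \<gamma> t"
proof -
  assume t: "t \<ge> 1"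
  have s: "sqrt (1 + t) > 0" using t by simp
  have "K / 2 * sqrt (1 + t) = K / sqrt (1 + t) * ((1 + t) / 2)"
    using s t by (simp add: field_simps)
  also have "\<dots> \<le> \<gamma> t * t" using \<gamma>_ge[of t] \<gamma>_pos[of t] t by (intro mult_mono) auto
  finally show ?thesis by (simp add: mult.commute)
qed

lemma E_cont: "continuous_on {1..} E"
  by (rule continuous_at_imp_continuous_on) (auto intro!: DERIV_isCont[OF E_DERIV])

lemma cumulated_energy_DERIV: "t > 1 \<Longrightarrow> (cumulated_energy has_real_derivative E t) (at t)"
  unfolding cumulated_energy_def by (rule integral_DERIV[OF E_cont])

lemma weighted_dissipation_DERIV: "t > 1 \<Longrightarrow> (weighted_dissipation has_real_derivative t * \<gamma> t * q t) (at t)"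
  using DERIV_diff[OF cumulated_energy_DERIV DERIV_mult[OF DERIV_ident E_DERIV], of t] by (simp add: weighted_dissipation_def[abs_def] algebra_simps)

text \<open>
  The arithmetic-geometric mean inequality for \<open>\<gamma> h\<close> and \<open>q / (2 \<gamma>)\<close>, whose product dominates \<open>k\<^sup>2 / 4\<close>.
\<close>

lemma k_plus_\<gamma>_h_ge: "t > 0 \<Longrightarrow> - (q t / (2 * \<gamma> t)) \<le> k t + \<gamma> t * h t"
proof -
  assume t: "t > 0"
  define a b where "a = \<gamma> t * h t" and "b = q t / (2 * \<gamma> t)"
  have g: "\<gamma> t > 0" using \<gamma>_pos t by simp
  have ab: "a \<ge> 0" "b \<ge> 0" unfolding a_def b_def using g h_nonneg[OF t] q_nonneg[OF t] by auto
  have "(k t)\<^sup>2 \<le> 4 * (a * b)" using k_sq[OF t] g by (simp add: a_def b_def)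
  also have "\<dots> \<le> (a + b)\<^sup>2"
    using zero_le_power2[of "a - b"] by (simp add: power2_eq_square algebra_simps)
  finally have "\<bar>k t\<bar> \<le> a + b" using ab by (simp add: abs_le_square_iff[symmetric])
  then show ?thesis unfolding a_def b_def by linarith
qed

lemma \<gamma>_isCont: "t > 0 \<Longrightarrow> isCont \<gamma> t"
  using continuous_on_interior[OF \<gamma>_cont, of t] by simp

text \<open>
  The function \<open>Y = k + \<gamma> h + \<integral>E - 3/10 (\<integral>E - t E)\<close> decreases as soon as \<open>t \<gamma> \<ge> 5\<close>: the term \<open>3/2 q\<close> in the
  slope of \<open>k\<close> is absorbed by \<open>3/10 t \<gamma> q\<close>. Since \<open>k + \<gamma> h \<ge> - t E / 5\<close>, what remains is \<open>7/10 \<integral>E \<le> Y\<close>.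
\<close>

lemma cumulated_energy_bounded: "\<exists>M. \<forall>t>1. cumulated_energy t \<le> M"
proof -
  \<comment> \<open>Beyond \<open>T\<close> the bound \<open>K / 2 * sqrt (1 + t)\<close> for \<open>t * \<gamma> t\<close> is at least \<open>5\<close>.\<close>
  define T where "T = max 2 ((10 / K)\<^sup>2)"
  have T: "T \<ge> 2" by (simp add: T_def)
  have big: "5 \<le> t * \<gamma> t" if "t \<ge> T" for t
  proof -
    have "10 / K = sqrt ((10 / K)\<^sup>2)" using K by simp
    also have "\<dots> \<le> sqrt (1 + t)" using that unfolding T_def by (intro real_sqrt_le_mono) linarith
    finally have "5 \<le> K / 2 * sqrt (1 + t)" using K by (simp add: field_simps)
    also have "\<dots> \<le> t * \<gamma> t" using that T by (intro t_\<gamma>_ge) simp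
    finally show ?thesis .
  qed
  define Y where "Y t = k t + (h t * \<gamma> t + (cumulated_energy t - 3/10 * weighted_dissipation t))" for t
  have slope: "slope_le Y 0 t" if t: "t \<ge> T" for t
  proof -
    have t0: "t > 1" using t T by simp
    \<comment> \<open>Here \<open>h\<close> is the nonnegative weight and the decreasing factor \<open>\<gamma>\<close> contributes slope \<open>0\<close>.\<close>
    have hg: "slope_le (\<lambda>t. h t * \<gamma> t) (k t * \<gamma> t + h t * 0) t"
      by (rule slope_le_mult[OF h_DERIV eventually_nhds_nonneg[OF _ h_nonneg] slope_le_antimono[OF \<gamma>_antimono] \<gamma>_isCont])
        (use t0 in auto)
    have "((\<lambda>t. cumulated_energy t - 3/10 * weighted_dissipation t) has_real_derivative E t - 3/10 * (t * \<gamma> t * q t)) (at t)"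
      using DERIV_diff[OF cumulated_energy_DERIV[OF t0] DERIV_cmult[OF weighted_dissipation_DERIV[OF t0], of "3/10"]] .
    from slope_le_add[OF k_slope slope_le_add[OF hg slope_le_DERIV[OF this]]] t0
    have "slope_le Y (3/2 * q t - \<gamma> t * k t - E t + (k t * \<gamma> t + h t * 0 + (E t - 3/10 * (t * \<gamma> t * q t)))) t"
      unfolding Y_def by simp
    moreover have "3/10 * (5 * q t) \<le> 3/10 * (t * \<gamma> t * q t)"
      using big[OF t] q_nonneg[of t] t0 by (intro mult_left_mono mult_right_mono) auto
    ultimately show ?thesis by - (erule slope_le_mono, simp add: algebra_simps)
  qed
  have le: "cumulated_energy t \<le> Y T / (7/10)" if t: "t \<ge> T" for t
  proof -
    have t0: "t > 0" using t T by simp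
    have "Y t \<le> Y T" by (rule slope_le_zero_imp_antimono[OF t slope])
    moreover have Yt: "Y t = k t + \<gamma> t * h t + 7/10 * cumulated_energy t + 3/10 * (t * E t)"
      by (simp add: Y_def weighted_dissipation_def field_simps)
    moreover have "q t / (2 * \<gamma> t) \<le> t * E t / 5"
    proof -
      have "q t / (2 * \<gamma> t) \<le> E t / \<gamma> t" using q_le[OF t0] \<gamma>_pos[of t] t0 by (simp add: field_simps)
      also have "\<dots> \<le> E t * (t / 5)"
      proof -
        have "1 / \<gamma> t \<le> t / 5" using big[OF t] \<gamma>_pos[of t] t0 by (simp add: field_simps)
        from mult_left_mono[OF this E_nonneg[OF t0]] show ?thesis by simp
      qed
      finally show ?thesis by (simp add: mult.commute)
    qed
    moreover have "0 \<le> t * E t" using t0 E_nonneg[OF t0] by simp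
    ultimately have "7/10 * cumulated_energy t \<le> Y T"
      using k_plus_\<gamma>_h_ge[OF t0] Yt by linarith
    then show ?thesis by simp
  qed
  have "cumulated_energy t \<le> Y T / (7/10)" if "t > 1" for t
  proof (cases "t \<ge> T")
    case False
    then have "cumulated_energy t \<le> cumulated_energy T"
      using that cumulated_energy_DERIV E_nonneg by (intro deriv_nonneg_imp_mono[of t T cumulated_energy E]) auto
    with le[of T] show ?thesis by simp
  qed (rule le)
  then show ?thesis by blast
qed

lemma weighted_dissipation_le: "t > 1 \<Longrightarrow> weighted_dissipation t \<le> cumulated_energy t"
  unfolding weighted_dissipation_def using E_nonneg[of t] by simp

lemma weighted_dissipation_mono: "1 < s \<Longrightarrow> s \<le> t \<Longrightarrow> weighted_dissipation s \<le> weighted_dissipation t"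
  by (rule deriv_nonneg_imp_mono[of s t weighted_dissipation "\<lambda>t. t * \<gamma> t * q t"])
    (use weighted_dissipation_DERIV \<gamma>_nonneg q_nonneg in \<open>auto intro!: mult_nonneg_nonneg\<close>)

lemma cumulated_energy_mono: "1 < s \<Longrightarrow> s \<le> t \<Longrightarrow> cumulated_energy s \<le> cumulated_energy t"
  by (rule deriv_nonneg_imp_mono[of s t cumulated_energy E]) (use cumulated_energy_DERIV E_nonneg in auto)

text \<open>
  As \<open>E\<close> decreases, \<open>t/2 * E t\<close> is at most the integral of \<open>E\<close> over \<open>[t/2, t]\<close>, which tends to zero by the
  Cauchy criterion.
\<close>

lemma energy_decay: "((\<lambda>t. t * E t) \<longlongrightarrow> 0) at_top"
proof -
  obtain M where M: "\<And>t. t > 1 \<Longrightarrow> cumulated_energy t \<le> M" using cumulated_energy_bounded by blast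
  obtain l where l: "(cumulated_energy \<longlongrightarrow> l) at_top" using tendsto_at_top_mono[of cumulated_energy M, OF cumulated_energy_mono M] by blast
  have half: "filterlim (\<lambda>t::real. t / 2) at_top at_top" by real_asymp
  have lim: "((\<lambda>t. 2 * (cumulated_energy t - cumulated_energy (t / 2))) \<longlongrightarrow> 2 * (l - l)) at_top"
    by (intro tendsto_intros l filterlim_compose[OF l half])
  have ub: "t * E t \<le> 2 * (cumulated_energy t - cumulated_energy (t / 2))" if "t \<ge> 4" for t
  proof -
    have "\<exists>x. t / 2 < x \<and> x < t \<and> cumulated_energy t - cumulated_energy (t / 2) = (t - t / 2) * E x"
      by (rule MVT2) (use that in \<open>auto intro!: cumulated_energy_DERIV\<close>)
    then obtain x where x: "t / 2 < x" "x < t" "cumulated_energy t - cumulated_energy (t / 2) = (t - t / 2) * E x" by (elim exE conjE)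
    have "t / 2 * E t \<le> t / 2 * E x" using x that by (intro mult_left_mono E_antimono) auto
    with x(3) show ?thesis by simp
  qed
  show ?thesis
  proof (rule tendsto_sandwich[OF _ _ tendsto_const])
    show "\<forall>\<^sub>F t in at_top. 0 \<le> t * E t"
      using eventually_gt_at_top[of 0] by eventually_elim (simp add: E_nonneg)
    show "\<forall>\<^sub>F t in at_top. t * E t \<le> 2 * (cumulated_energy t - cumulated_energy (t / 2))"
      using eventually_ge_at_top[of 4] by eventually_elim (rule ub)
    show "((\<lambda>t. 2 * (cumulated_energy t - cumulated_energy (t / 2))) \<longlongrightarrow> 0) at_top" using lim by simp
  qed
qed

text \<open>
  The weight is \<open>\<theta> t = exp (G t) * (L - Q t)\<close> with \<open>G' = \<gamma>\<close>, \<open>Q' = exp (- G)\<close> and \<open>L\<close> the limit of \<open>Q\<close>: the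
  solution of \<open>\<theta>' = \<gamma> \<theta> - 1\<close> that does not grow exponentially. Its size is compared with the
  supersolution \<open>\<psi> = 2 / K * sqrt (1 + t)\<close>, for which \<open>\<gamma> \<psi> - \<psi>' \<ge> 1\<close> at large times; this makes
  \<open>P = exp (- G) * \<psi> + Q\<close> decreasing, whence \<open>L - Q \<le> exp (- G) * \<psi>\<close>.
\<close>

lemma weight_exists:
  "\<exists>\<theta> T. T \<ge> 1 \<and> (\<forall>t>T. (\<theta> has_real_derivative \<gamma> t * \<theta> t - 1) (at t) \<and>
     0 \<le> \<theta> t \<and> \<theta> t \<le> 2 / K * sqrt (1 + t))"
proof -
  define T where "T = max 2 ((1 / K)\<^sup>2)"
  have T: "T \<ge> 2" by (simp add: T_def)
  define G where "G t = integral {1..t} \<gamma>" for t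
  have G: "(G has_real_derivative \<gamma> t) (at t)" if "t > 1" for t
    unfolding G_def by (rule integral_DERIV[OF continuous_on_subset[OF \<gamma>_cont] that]) auto
  have "continuous_on {2..} G"
    by (rule continuous_at_imp_continuous_on) (auto intro!: DERIV_isCont[OF G])
  define Q where "Q t = integral {2..t} (\<lambda>s. exp (- G s))" for t
  have Q: "(Q has_real_derivative exp (- G t)) (at t)" if "t > 2" for t
    unfolding Q_def by (rule integral_DERIV[OF _ that]) (intro continuous_intros \<open>continuous_on {2..} G\<close>)
  define \<psi> where "\<psi> t = 2 / K * sqrt (1 + t)" for t
  define P where "P t = exp (- G t) * \<psi> t + Q t" for t
  have P: "P t \<le> P s" if s: "T < s" "s \<le> t" for s t
  proof (rule DERIV_nonpos_imp_nonincreasing[OF s(2)])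
    fix x assume x: "s \<le> x" "x \<le> t"
    have xp: "x > 2" "x > 1" "1 + x > 0" using x s T by auto
    have d: "(P has_real_derivative exp (- G x) * (1 / (K * sqrt (1 + x)) - \<gamma> x * \<psi> x + 1)) (at x)"
    proof -
      have "(\<psi> has_real_derivative 2 / K * (inverse (sqrt (1 + x)) / 2 * 1)) (at x)"
        unfolding \<psi>_def using xp
        by (intro DERIV_cmult DERIV_chain2[OF DERIV_real_sqrt]) (auto intro!: derivative_eq_intros)
      then have \<psi>': "(\<psi> has_real_derivative 1 / (K * sqrt (1 + x))) (at x)" by (simp add: field_simps)
      have "((\<lambda>t. exp (- G t)) has_real_derivative exp (- G x) * - \<gamma> x) (at x)"
        by (rule DERIV_chain2[OF DERIV_exp DERIV_minus[OF G[OF xp(2)]]])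
      from DERIV_add[OF DERIV_mult[OF this \<psi>'] Q[OF xp(1)]]
      show ?thesis unfolding P_def by (rule DERIV_cong) (simp add: algebra_simps)
    qed
    have "1 / K = sqrt ((1 / K)\<^sup>2)" using K by simp
    also have "\<dots> \<le> sqrt (1 + x)" using x s unfolding T_def by (intro real_sqrt_le_mono) linarith
    finally have "1 / (K * sqrt (1 + x)) \<le> 1" using K xp by (simp add: field_simps)
    moreover have "2 \<le> \<gamma> x * \<psi> x"
    proof -
      have "2 = K / sqrt (1 + x) * \<psi> x" using K xp by (simp add: \<psi>_def)
      also have "\<dots> \<le> \<gamma> x * \<psi> x" using \<gamma>_ge[of x] xp K by (intro mult_right_mono) (auto simp: \<psi>_def)
      finally show ?thesis .
    qed
    ultimately have "exp (- G x) * (1 / (K * sqrt (1 + x)) - \<gamma> x * \<psi> x + 1) \<le> 0"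
      by (intro mult_nonneg_nonpos) auto
    with d show "\<exists>y. (P has_real_derivative y) (at x) \<and> y \<le> 0" by blast
  qed
  have \<psi>0: "\<psi> t \<ge> 0" if "t > T" for t using that T K by (simp add: \<psi>_def)
  have QP: "Q s \<le> P s" if "s > T" for s using \<psi>0[OF that] by (simp add: P_def)
  have Qm: "Q s \<le> Q t" if "T < s" "s \<le> t" for s t
    by (rule deriv_nonneg_imp_mono[OF _ _ that(2), of Q "\<lambda>t. exp (- G t)"]) (use Q that T in auto)
  have Qle: "Q s \<le> P t" if "T < s" "T < t" for s t
  proof -
    have "Q s \<le> Q (max s t)" using that by (intro Qm) auto
    also have "\<dots> \<le> P (max s t)" using that by (intro QP) auto
    also have "\<dots> \<le> P t" using that by (intro P) auto
    finally show ?thesis .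
  qed
  define L where "L = Sup (Q ` {T<..})"
  have bdd: "bdd_above (Q ` {T<..})" by (rule bdd_aboveI2[of _ _ "P (T + 1)"]) (use Qle in auto)
  define \<theta> where "\<theta> t = exp (G t) * (L - Q t)" for t
  have "(\<theta> has_real_derivative \<gamma> t * \<theta> t - 1) (at t) \<and> 0 \<le> \<theta> t \<and> \<theta> t \<le> \<psi> t" if t: "t > T" for t
  proof (intro conjI)
    have t2: "t > 1" "t > 2" using t T by auto
    show "(\<theta> has_real_derivative \<gamma> t * \<theta> t - 1) (at t)"
      unfolding \<theta>_def
      using DERIV_mult[OF DERIV_chain2[OF DERIV_exp G[OF t2(1)]] DERIV_diff[OF DERIV_const[of L] Q[OF t2(2)]]]
      by (rule DERIV_cong) (simp add: exp_minus)
    have "Q t \<le> L" unfolding L_def by (rule cSup_upper[OF _ bdd]) (use t in auto)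
    then show "0 \<le> \<theta> t" by (simp add: \<theta>_def)
    have "L \<le> P t" unfolding L_def by (rule cSup_least) (use Qle t in auto)
    then have "exp (G t) * (L - Q t) \<le> exp (G t) * (exp (- G t) * \<psi> t)"
      unfolding P_def by (intro mult_left_mono) auto
    also have "\<dots> = \<psi> t" by (simp add: mult.assoc[symmetric] exp_add[symmetric])
    finally show "\<theta> t \<le> \<psi> t" by (simp only: \<theta>_def)
  qed
  then show ?thesis using T unfolding \<psi>_def by (intro exI[of _ \<theta>] exI[of _ T]) auto
qed

text \<open>
  By the choice of \<open>\<theta>\<close>, the terms with \<open>k\<close> cancel in the slope of \<open>\<theta> k + h\<close>, and subtracting a multiple of the
  weighted dissipation makes this function decreasing. The term \<open>\<theta> k\<close> is negligible since
  \<open>(\<theta> k)\<^sup>2 \<le> 2 h w\<close> with \<open>w = \<theta>\<^sup>2 q = O(t E)\<close>; first this bounds \<open>h\<close>, then it shows \<open>\<theta> k \<rightarrow> 0\<close>.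
\<close>

lemma h_converges: "\<exists>l. (h \<longlongrightarrow> l) at_top"
proof -
  obtain M where "\<And>t. t > 1 \<Longrightarrow> cumulated_energy t \<le> M" using cumulated_energy_bounded by blast
  then have M: "weighted_dissipation t \<le> M" if "t > 1" for t using weighted_dissipation_le[OF that] that by fastforce
  obtain \<sigma> where \<sigma>: "(weighted_dissipation \<longlongrightarrow> \<sigma>) at_top" using tendsto_at_top_mono[of weighted_dissipation M, OF weighted_dissipation_mono M] by blast
  obtain \<theta> T where T: "T \<ge> 1" and weight: "\<forall>t>T. (\<theta> has_real_derivative \<gamma> t * \<theta> t - 1) (at t) \<and>
      0 \<le> \<theta> t \<and> \<theta> t \<le> 2 / K * sqrt (1 + t)"
    using weight_exists by (elim exE conjE)
  then have \<theta>: "\<And>t. t > T \<Longrightarrow> (\<theta> has_real_derivative \<gamma> t * \<theta> t - 1) (at t)"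
    and \<theta>0: "\<And>t. t > T \<Longrightarrow> 0 \<le> \<theta> t" and \<theta>_le: "\<And>t. t > T \<Longrightarrow> \<theta> t \<le> 2 / K * sqrt (1 + t)"
    by simp_all
  \<comment> \<open>The factor for which \<open>3/2 * (2 / K * sqrt (1 + t))\<close> equals \<open>c\<close> times the lower bound
    \<open>K / 2 * sqrt (1 + t)\<close> of \<open>t * \<gamma> t\<close>.\<close>
  define c where "c = 6 / K\<^sup>2"
  have c: "c > 0" using K by (simp add: c_def)
  define D where "D t = \<theta> t * k t + (h t - c * weighted_dissipation t)" for t
  have slope: "slope_le D 0 t" if t: "t > T" for t
  proof -
    have t0: "t > 0" "t > 1" using t T by auto
    have "\<forall>\<^sub>F s in nhds t. 0 \<le> \<theta> s"
      by (rule eventually_mono[OF eventually_nhds_in_open[of "{T<..}"]]) (use t \<theta>0 in auto)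
    from slope_le_mult[OF \<theta>[OF t] this k_slope[OF t0(1)] k_cont[OF t0(1)]]
    have tk: "slope_le (\<lambda>t. \<theta> t * k t) ((\<gamma> t * \<theta> t - 1) * k t + \<theta> t * (3/2 * q t - \<gamma> t * k t - E t)) t" .
    have "((\<lambda>t. h t - c * weighted_dissipation t) has_real_derivative k t - c * (t * \<gamma> t * q t)) (at t)"
      using DERIV_diff[OF h_DERIV[OF t0(1)] DERIV_cmult[OF weighted_dissipation_DERIV[OF t0(2)], of c]] .
    from slope_le_add[OF tk slope_le_DERIV[OF this]]
    have "slope_le D ((\<gamma> t * \<theta> t - 1) * k t + \<theta> t * (3/2 * q t - \<gamma> t * k t - E t) + (k t - c * (t * \<gamma> t * q t))) t"
      unfolding D_def .
    moreover have "\<theta> t * (3/2) * q t \<le> c * (t * \<gamma> t) * q t"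
    proof (rule mult_right_mono[OF _ q_nonneg[OF t0(1)]])
      have "\<theta> t * (3/2) \<le> 2 / K * sqrt (1 + t) * (3/2)" using \<theta>_le[OF t] by (rule mult_right_mono) simp
      also have "\<dots> = c * (K / 2 * sqrt (1 + t))" using K by (simp add: c_def power2_eq_square)
      also have "\<dots> \<le> c * (t * \<gamma> t)" using t_\<gamma>_ge[of t] t0 c by (intro mult_left_mono) auto
      finally show "\<theta> t * (3/2) \<le> c * (t * \<gamma> t)" .
    qed
    moreover have "0 \<le> \<theta> t * E t" using \<theta>0[OF t] E_nonneg[OF t0(1)] by simp
    ultimately show ?thesis by - (erule slope_le_mono, simp add: algebra_simps)
  qed
  have D_anti: "D t \<le> D s" if "T < s" "s \<le> t" for s t
    by (rule slope_le_zero_imp_antimono[OF that(2) slope]) (use that in auto)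
  define w where "w t = (\<theta> t)\<^sup>2 * q t" for t
  have w0: "w t \<ge> 0" if "t > T" for t using q_nonneg[of t] that T by (simp add: w_def)
  have w: "(w \<longlongrightarrow> 0) at_top"
  proof (rule tendsto_sandwich[OF _ _ tendsto_const])
    show "\<forall>\<^sub>F t in at_top. 0 \<le> w t" using eventually_gt_at_top[of T] by eventually_elim (rule w0)
    show "\<forall>\<^sub>F t in at_top. w t \<le> 16 / K\<^sup>2 * (t * E t)"
      using eventually_gt_at_top[of T]
    proof eventually_elim
      case (elim t)
      then have t0: "t > 0" "t > 1" using T by auto
      have "(\<theta> t)\<^sup>2 \<le> (2 / K * sqrt (1 + t))\<^sup>2" using \<theta>0[OF elim] \<theta>_le[OF elim] by (rule power_mono[rotated])
      also have "\<dots> = 4 / K\<^sup>2 * (1 + t)" using t0 by (simp add: power_mult_distrib power_divide)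
      also have "\<dots> \<le> 4 / K\<^sup>2 * (2 * t)" using t0 by (intro mult_left_mono) auto
      finally have "w t \<le> 4 / K\<^sup>2 * (2 * t) * (2 * E t)"
        unfolding w_def using q_le[OF t0(1)] q_nonneg[OF t0(1)] t0 by (intro mult_mono) auto
      then show ?case by (simp add: mult_ac)
    qed
    show "((\<lambda>t. 16 / K\<^sup>2 * (t * E t)) \<longlongrightarrow> 0) at_top"
      using tendsto_mult_left[OF energy_decay, of "16 / K\<^sup>2"] by simp
  qed
  have tk_sq: "(\<theta> t * k t)\<^sup>2 \<le> 2 * h t * w t" if "t > T" for t
  proof -
    have "(\<theta> t)\<^sup>2 * (k t)\<^sup>2 \<le> (\<theta> t)\<^sup>2 * (2 * h t * q t)" using k_sq[of t] that T by (intro mult_left_mono) auto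
    then show ?thesis by (simp add: w_def power_mult_distrib mult_ac)
  qed
  have tk_abs: "\<bar>\<theta> t * k t\<bar> \<le> h t / 2 + w t" if t: "t > T" for t
  proof -
    have h0: "h t \<ge> 0" using h_nonneg[of t] t T by simp
    have "(\<theta> t * k t)\<^sup>2 \<le> 2 * h t * w t" by (rule tk_sq[OF t])
    also have "\<dots> \<le> (h t / 2 + w t)\<^sup>2"
      using zero_le_power2[of "h t / 2 - w t"] by (simp add: power2_eq_square algebra_simps)
    finally show ?thesis using h0 w0[OF t] by (simp add: abs_le_square_iff[symmetric])
  qed
  have "\<forall>\<^sub>F t in at_top. w t < 1" using w by (rule order_tendstoD) simp
  then obtain T' where T': "\<And>t. t \<ge> T' \<Longrightarrow> w t < 1" unfolding eventually_at_top_linorder by blast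
  define T1 where "T1 = max (T + 1) T'"
  have T1: "t > T \<and> w t < 1 \<and> t > 1" if "t \<ge> T1" for t using that T'[of t] T by (auto simp: T1_def)
  have D_lower: "h t / 2 - 1 - c * M \<le> D t" if "t \<ge> T1" for t
  proof -
    have "c * weighted_dissipation t \<le> c * M" using M[of t] T1[OF that] c by (intro mult_left_mono) auto
    then show ?thesis using tk_abs[of t] T1[OF that] unfolding D_def by (simp add: abs_le_iff)
  qed
  have "\<exists>d. (D \<longlongrightarrow> d) at_top"
  proof (rule tendsto_at_top_antimono[of T1])
    show "D t \<le> D s" if "T1 \<le> s" "s \<le> t" for s t using D_anti[of s t] T1[of s] that by simp
    show "- 1 - c * M \<le> D t" if "T1 \<le> t" for t
      using D_lower[OF that] h_nonneg[of t] T1[OF that] by simp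
  qed
  then obtain d where d: "(D \<longlongrightarrow> d) at_top" by blast
  define B where "B = 2 * (D T1 + 1 + c * M)"
  have hB: "h t \<le> B" if "t \<ge> T1" for t
    using D_lower[OF that] D_anti[of T1 t] T1[of T1] that unfolding B_def by simp
  have "((\<lambda>t. (\<theta> t * k t)\<^sup>2) \<longlongrightarrow> 0) at_top"
  proof (rule tendsto_sandwich[OF _ _ tendsto_const])
    show "\<forall>\<^sub>F t in at_top. (\<theta> t * k t)\<^sup>2 \<le> 2 * B * w t"
      using eventually_ge_at_top[of T1]
    proof eventually_elim
      case (elim t)
      have "(\<theta> t * k t)\<^sup>2 \<le> 2 * h t * w t" using tk_sq T1[OF elim] by simp
      also have "\<dots> \<le> 2 * B * w t" using hB[OF elim] w0[of t] T1[OF elim] by (intro mult_right_mono) auto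
      finally show ?case .
    qed
    show "((\<lambda>t. 2 * B * w t) \<longlongrightarrow> 0) at_top" using tendsto_mult_left[OF w, of "2 * B"] by simp
  qed simp
  then have "((\<lambda>t. sqrt ((\<theta> t * k t)\<^sup>2)) \<longlongrightarrow> sqrt 0) at_top" by (rule tendsto_real_sqrt)
  then have tk: "((\<lambda>t. \<theta> t * k t) \<longlongrightarrow> 0) at_top" by (simp add: tendsto_rabs_zero_iff)
  have "((\<lambda>t. D t - \<theta> t * k t + c * weighted_dissipation t) \<longlongrightarrow> d - 0 + c * \<sigma>) at_top"
    by (intro tendsto_intros d tk \<sigma>)
  then show ?thesis by (auto simp: D_def)
qed

end

section \<open>Weak cluster points in Hilbert spaces\<close>

text \<open>
  Almost minimal elements of the sets form a Cauchy sequence: the midpoint of two of them lies in the larger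
  set, so its norm is almost as large as theirs, and the parallelogram identity makes them close.
\<close>

lemma nested_closed_convex_sets:
  fixes C :: "nat \<Rightarrow> 'a::{real_inner, complete_space} set"
  assumes closed: "\<And>n. closed (C n)" and convex: "\<And>n. convex (C n)" and ne: "\<And>n. C n \<noteq> {}"
    and dec: "decseq C" and bdd: "bounded (C 0)"
  shows "\<exists>x. \<forall>n. x \<in> C n"
proof -
  define d where "d n = Inf (norm ` C n)" for n
  have bb: "bdd_below (norm ` C n)" for n by (rule bdd_belowI2[of _ 0]) simp
  have d_le: "d n \<le> norm x" if "x \<in> C n" for n x
    unfolding d_def by (rule cInf_lower[OF _ bb]) (use that in auto)
  have sub: "C m \<subseteq> C n" if "n \<le> m" for n m using dec that by (auto simp: decseq_def)
  have d_mono: "d n \<le> d m" if "n \<le> m" for n m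
    unfolding d_def[of m] by (rule cInf_greatest) (use ne d_le sub[OF that] in auto)
  obtain B where B: "\<And>x. x \<in> C 0 \<Longrightarrow> norm x \<le> B" using bdd unfolding bounded_iff by blast
  have d_B: "d n \<le> B" for n
  proof -
    obtain x where "x \<in> C n" using ne by blast
    then show ?thesis using d_le[of x n] B[of x] sub[of 0 n] by auto
  qed
  have d0: "0 \<le> d n" for n unfolding d_def by (rule cInf_greatest) (use ne in auto)
  have "incseq d" using d_mono by (auto simp: incseq_def)
  then obtain L where L: "d \<longlonglongrightarrow> L" "\<And>n. d n \<le> L"
    using incseq_convergent[of d B] d_B by blast
  have "\<exists>x. x \<in> C n \<and> norm x < d n + 1 / (1 + real n)" for n
    using cInf_lessD[of "norm ` C n" "d n + 1 / (1 + real n)"] ne[of n] unfolding d_def by auto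
  then obtain x where x: "\<And>n. x n \<in> C n" "\<And>n. norm (x n) < d n + 1 / (1 + real n)" by metis
  define \<beta> where "\<beta> n = 4 * ((L + 1 / (1 + real n))\<^sup>2 - (d n)\<^sup>2)" for n
  have dist: "(norm (x n - x m))\<^sup>2 \<le> \<beta> n" if nm: "n \<le> m" for n m
  proof -
    have xm: "x m \<in> C n" using x(1) sub[OF nm] by blast
    have "(1/2) *\<^sub>R x n + (1/2) *\<^sub>R x m \<in> C n" by (rule convexD[OF convex x(1) xm]) auto
    then have "d n \<le> norm ((1/2) *\<^sub>R x n + (1/2) *\<^sub>R x m)" by (rule d_le)
    also have "\<dots> = norm (x n + x m) / 2" by (simp add: scaleR_add_right[symmetric])
    finally have 1: "(2 * d n)\<^sup>2 \<le> (norm (x n + x m))\<^sup>2" using d0[of n] by (intro power_mono) auto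
    have "norm (x n) \<le> L + 1 / (1 + real n)" using x(2)[of n] L(2)[of n] by simp
    moreover have "norm (x m) \<le> L + 1 / (1 + real n)"
    proof -
      have "1 / (1 + real m) \<le> 1 / (1 + real n)" using nm by (intro divide_left_mono) auto
      then show ?thesis using x(2)[of m] L(2)[of m] by simp
    qed
    ultimately have "(norm (x n))\<^sup>2 \<le> (L + 1 / (1 + real n))\<^sup>2" "(norm (x m))\<^sup>2 \<le> (L + 1 / (1 + real n))\<^sup>2"
      by (auto intro: power_mono)
    moreover have "(norm (x n - x m))\<^sup>2 + (norm (x n + x m))\<^sup>2 = 2 * (norm (x n))\<^sup>2 + 2 * (norm (x m))\<^sup>2"
      by (simp add: power2_norm_eq_inner inner_add_left inner_add_right inner_diff_left inner_diff_right)
    ultimately show ?thesis using 1 by (simp add: \<beta>_def power_mult_distrib)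
  qed
  have "(\<lambda>n. 1 / (1 + real n)) \<longlonglongrightarrow> 0"
    using LIMSEQ_inverse_real_of_nat by (simp add: inverse_eq_divide add.commute)
  then have "\<beta> \<longlonglongrightarrow> 4 * ((L + 0)\<^sup>2 - L\<^sup>2)" unfolding \<beta>_def by (intro tendsto_intros L(1))
  then have \<beta>: "\<beta> \<longlonglongrightarrow> 0" by simp
  have "Cauchy x"
  proof (rule CauchyI')
    fix e :: real assume e: "e > 0"
    then have "\<forall>\<^sub>F n in sequentially. \<beta> n < e\<^sup>2" using \<beta> by (intro order_tendstoD) auto
    then obtain N where N: "\<And>n. n \<ge> N \<Longrightarrow> \<beta> n < e\<^sup>2" unfolding eventually_sequentially by blast
    show "\<exists>M. \<forall>m\<ge>M. \<forall>n>m. dist (x m) (x n) < e"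
    proof (intro exI[of _ N] allI impI)
      fix m n assume "N \<le> m" "m < n"
      then have "(norm (x m - x n))\<^sup>2 < e\<^sup>2" using dist[of m n] N[of m] by simp
      from power_less_imp_less_base[OF this] e show "dist (x m) (x n) < e" by (simp add: dist_norm)
    qed
  qed
  then obtain l where l: "x \<longlonglongrightarrow> l" using Cauchy_convergent unfolding convergent_def by blast
  have "l \<in> C n" for n
  proof (rule Lim_in_closed_set[OF closed _ sequentially_bot l])
    show "\<forall>\<^sub>F m in sequentially. x m \<in> C n"
      using eventually_ge_at_top[of n] by eventually_elim (use x(1) sub in blast)
  qed
  then show ?thesis by blast
qed

lemma closed_convex_halfspace:
  fixes \<psi> :: "'a::real_normed_vector \<Rightarrow>\<^sub>L real"
  shows "closed {x. \<psi> x \<le> c}" "convex {x. \<psi> x \<le> c}"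
proof -
  show "closed {x. \<psi> x \<le> c}" by (intro closed_Collect_le continuous_intros)
  have "convex (blinfun_apply \<psi> -` {..c})"
    by (intro convex_linear_vimage bounded_linear.linear blinfun.bounded_linear_right) auto
  then show "convex {x. \<psi> x \<le> c}" by (simp add: vimage_def)
qed

text \<open>
  The intersection of the closed convex hulls of the tails of \<open>u\<close> along \<open>P\<close>, described by the half-spaces that
  contain a tail. The predicate \<open>P\<close> selects the times that are kept.
\<close>

definition weak_hull_at_top :: "(real \<Rightarrow> bool) \<Rightarrow> (real \<Rightarrow> 'a::real_normed_vector) \<Rightarrow> 'a set" where
  "weak_hull_at_top P u =
     {x. \<forall>\<psi> :: 'a \<Rightarrow>\<^sub>L real. \<forall>c. (\<forall>\<^sub>F t in at_top. P t \<longrightarrow> \<psi> (u t) \<le> c) \<longrightarrow> \<psi> x \<le> c}"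

lemma weak_hull_at_topD:
  fixes \<psi> :: "'a::real_normed_vector \<Rightarrow>\<^sub>L real"
  assumes "x \<in> weak_hull_at_top P u" "\<forall>\<^sub>F t in at_top. P t \<longrightarrow> \<psi> (u t) \<le> c"
  shows "\<psi> x \<le> c"
  using assms unfolding weak_hull_at_top_def by simp

lemma weak_hull_at_top_nonempty:
  fixes u :: "real \<Rightarrow> 'a::{real_inner, complete_space}"
  assumes bdd: "\<forall>\<^sub>F t in at_top. norm (u t) \<le> B" and freq: "\<exists>\<^sub>F t in at_top. P t"
  shows "weak_hull_at_top P u \<noteq> {}"
proof -
  obtain T where T: "\<And>t. t \<ge> T \<Longrightarrow> norm (u t) \<le> B" using bdd unfolding eventually_at_top_linorder by blast
  define C where "C n = closure (convex hull (u ` {t. T + real n \<le> t \<and> P t}))" for n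
  have inC: "u t \<in> C n" if "T + real n \<le> t" "P t" for t n
    unfolding C_def by (rule subsetD[OF closure_subset], rule hull_inc) (use that in auto)
  have min: "C n \<subseteq> S" if "closed S" "convex S" "\<And>t. T + real n \<le> t \<Longrightarrow> P t \<Longrightarrow> u t \<in> S" for S n
    unfolding C_def by (intro closure_minimal hull_minimal) (use that in auto)
  have cl: "closed (C n)" "convex (C n)" for n unfolding C_def by (auto intro: convex_closure)
  have "\<exists>x. \<forall>n. x \<in> C n"
  proof (rule nested_closed_convex_sets[OF cl])
    show "C n \<noteq> {}" for n
      using freq inC unfolding frequently_def eventually_at_top_linorder by fastforce
    show "decseq C"
      unfolding decseq_def by (intro allI impI min cl inC) auto
    have "C 0 \<subseteq> cball 0 B" by (rule min) (use T in auto)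
    then show "bounded (C 0)" using bounded_cball bounded_subset by blast
  qed
  then obtain x where x: "\<And>n. x \<in> C n" by blast
  have "x \<in> weak_hull_at_top P u"
    unfolding weak_hull_at_top_def
  proof (intro CollectI allI impI)
    fix \<psi> :: "'a \<Rightarrow>\<^sub>L real" and c assume "\<forall>\<^sub>F t in at_top. P t \<longrightarrow> \<psi> (u t) \<le> c"
    then obtain s where s: "\<And>t. t \<ge> s \<Longrightarrow> P t \<Longrightarrow> \<psi> (u t) \<le> c"
      unfolding eventually_at_top_linorder by blast
    obtain n :: nat where n: "s - T \<le> real n" using real_arch_simple by blast
    have "C n \<subseteq> {x. \<psi> x \<le> c}" by (rule min[OF closed_convex_halfspace]) (use s n in auto)
    then show "\<psi> x \<le> c" using x[of n] by blast
  qed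
  then show ?thesis by blast
qed

lemma weak_hull_at_top_limit:
  fixes \<psi> :: "'a::real_normed_vector \<Rightarrow>\<^sub>L real"
  assumes x: "x \<in> weak_hull_at_top P u" and lim: "((\<lambda>t. \<psi> (u t)) \<longlongrightarrow> c) at_top"
  shows "\<psi> x = c"
proof (rule antisym; rule field_le_epsilon)
  fix e :: real assume e: "e > 0"
  have "\<forall>\<^sub>F t in at_top. \<psi> (u t) < c + e" using e by (intro order_tendstoD(2)[OF lim]) simp
  then have "\<forall>\<^sub>F t in at_top. P t \<longrightarrow> \<psi> (u t) \<le> c + e" by (auto elim!: eventually_mono)
  then show "\<psi> x \<le> c + e" by (rule weak_hull_at_topD[OF x])
  have "\<forall>\<^sub>F t in at_top. c - e < \<psi> (u t)" using e by (intro order_tendstoD(1)[OF lim]) simp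
  then have "\<forall>\<^sub>F t in at_top. P t \<longrightarrow> (- \<psi>) (u t) \<le> - c + e"
    by (auto elim!: eventually_mono simp: blinfun.minus_left)
  from weak_hull_at_topD[OF x this] show "c \<le> \<psi> x + e" by (simp add: blinfun.minus_left)
qed

text \<open>
  If \<open>\<psi> (u t)\<close> exceeded \<open>\<psi> l + e\<close> at arbitrarily large times, then the hull along those times would contain
  a point on the wrong side of this hyperplane; but that point lies in the full hull, so it is \<open>l\<close>.
\<close>

lemma weakly_tendsto_if_weak_hull_subset_singleton:
  fixes u :: "real \<Rightarrow> 'a::{real_inner, complete_space}"
  assumes bdd: "\<forall>\<^sub>F t in at_top. norm (u t) \<le> B" and sub: "weak_hull_at_top (\<lambda>_. True) u \<subseteq> {l}"
  shows "weakly_tendsto u l at_top"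
proof -
  have upper: "\<forall>\<^sub>F t in at_top. \<psi> (u t) < \<psi> l + e" if e: "e > 0" for \<psi> :: "'a \<Rightarrow>\<^sub>L real" and e
  proof (rule ccontr)
    let ?P = "\<lambda>t. \<psi> l + e \<le> \<psi> (u t)"
    assume "\<not> ?thesis"
    then have "\<exists>\<^sub>F t in at_top. ?P t" by (simp add: frequently_def not_le)
    from weak_hull_at_top_nonempty[OF bdd this] obtain x where x: "x \<in> weak_hull_at_top ?P u" by auto
    have "x \<in> weak_hull_at_top (\<lambda>_. True) u"
      unfolding weak_hull_at_top_def
    proof (intro CollectI allI impI)
      fix \<phi> :: "'a \<Rightarrow>\<^sub>L real" and c assume "\<forall>\<^sub>F t in at_top. True \<longrightarrow> \<phi> (u t) \<le> c"
      then have "\<forall>\<^sub>F t in at_top. ?P t \<longrightarrow> \<phi> (u t) \<le> c" by (rule eventually_mono) simp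
      then show "\<phi> x \<le> c" by (rule weak_hull_at_topD[OF x])
    qed
    then have "x = l" using sub by blast
    have "(- \<psi>) x \<le> - (\<psi> l + e)"
      by (rule weak_hull_at_topD[OF x]) (simp add: blinfun.minus_left)
    then show False using \<open>x = l\<close> e by (simp add: blinfun.minus_left)
  qed
  show ?thesis
    unfolding weakly_tendsto_def tendsto_iff
  proof (intro allI impI)
    fix \<psi> :: "'a \<Rightarrow>\<^sub>L real" and e :: real assume e: "e > 0"
    from upper[OF e, of \<psi>] upper[OF e, of "- \<psi>"] show "\<forall>\<^sub>F t in at_top. dist (\<psi> (u t)) (\<psi> l) < e"
      by eventually_elim (auto simp: dist_real_def blinfun.minus_left)
  qed
qed

section \<open>The energy and the distance to a minimiser along a solution\<close>

text \<open>
  Reduce to the real function \<open>s \<mapsto> F (v + s (w - v))\<close>.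
\<close>

lemma convex_on_gradient_inequality:
  fixes F :: "'a::real_normed_vector \<Rightarrow> real"
  assumes F: "convex_on UNIV F" and D: "(F has_derivative D) (at v)"
  shows "F v + D (w - v) \<le> F w"
proof -
  define g where "g s = F (v + s *\<^sub>R (w - v))" for s :: real
  have "convex_on UNIV g"
  proof (rule convex_onI)
    fix t x y :: real assume t: "0 < t" "t < 1"
    have "v + ((1 - t) * x + t * y) *\<^sub>R (w - v) = (1 - t) *\<^sub>R (v + x *\<^sub>R (w - v)) + t *\<^sub>R (v + y *\<^sub>R (w - v))"
      by (simp add: algebra_simps)
    then show "g ((1 - t) *\<^sub>R x + t *\<^sub>R y) \<le> (1 - t) * g x + t * g y"
      using convex_onD[OF F, of t "v + x *\<^sub>R (w - v)" "v + y *\<^sub>R (w - v)"] t by (simp add: g_def)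
  qed simp
  moreover have "(g has_real_derivative D (w - v)) (at 0)"
  proof -
    have 1: "((\<lambda>s. v + s *\<^sub>R (w - v)) has_derivative (\<lambda>s. s *\<^sub>R (w - v))) (at (0::real))"
      by (auto intro!: derivative_eq_intros)
    have 2: "(F has_derivative D) (at (v + 0 *\<^sub>R (w - v)))" using D by simp
    from has_derivative_compose[OF 1 2] have "(g has_derivative (\<lambda>s. D (s *\<^sub>R (w - v)))) (at 0)"
      by (simp add: g_def[abs_def])
    moreover have "(\<lambda>s. D (s *\<^sub>R (w - v))) = (\<lambda>s. D (w - v) * s)"
      using linear_scale[OF has_derivative_linear[OF D]] by (auto simp: mult.commute)
    ultimately show ?thesis by (simp add: has_field_derivative_def)
  qed
  ultimately have "D (w - v) * (1 - 0) \<le> g 1 - g 0"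
    by (intro convex_on_imp_above_tangent[of UNIV]) auto
  then show ?thesis by (simp add: g_def)
qed

lemma has_derivative_kinetic_plus_potential:
  fixes \<phi> :: "'v::real_inner \<Rightarrow> real" and \<phi>' :: "'v \<Rightarrow> 'v \<Rightarrow>\<^sub>L real" and x :: "'v \<times> 'h::real_inner"
  assumes "\<And>v. (\<phi> has_derivative \<phi>' v) (at v)"
  shows "((\<lambda>x. 1/2 * (norm (snd x))\<^sup>2 + \<phi> (fst x)) has_derivative
      ((blinfun_inner_right (snd x) o\<^sub>L snd_blinfun) + (\<phi>' (fst x) o\<^sub>L fst_blinfun))) (at x)"
proof -
  have "((\<lambda>x::'v \<times> 'h. \<phi> (fst x)) has_derivative (\<lambda>d. \<phi>' (fst x) (fst d))) (at x)"
    by (rule has_derivative_compose[OF has_derivative_fst[OF has_derivative_ident] assms])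
  moreover have "((\<lambda>x::'v \<times> 'h. 1/2 * inner (snd x) (snd x)) has_derivative (\<lambda>d. inner (snd x) (snd d))) (at x)"
    by (auto intro!: derivative_eq_intros simp: inner_commute)
  ultimately have "((\<lambda>x. 1/2 * inner (snd x) (snd x) + \<phi> (fst x)) has_derivative
      (\<lambda>d. inner (snd x) (snd d) + \<phi>' (fst x) (fst d))) (at x)"
    by (rule has_derivative_add[rotated])
  then show ?thesis by (simp add: power2_norm_eq_inner plus_blinfun.rep_eq)
qed

lemma has_derivative_inner_affine:
  fixes J :: "'v::real_inner \<Rightarrow>\<^sub>L 'h::real_inner" and x :: "'v \<times> 'h"
  shows "((\<lambda>x. inner (J (fst x) - z) (snd x)) has_derivative
      ((blinfun_inner_right (snd x) o\<^sub>L (J o\<^sub>L fst_blinfun)) + (blinfun_inner_right (J (fst x) - z) o\<^sub>L snd_blinfun))) (at x)"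
proof -
  have "((\<lambda>x::'v \<times> 'h. J (fst x) - z) has_derivative (\<lambda>d. J (fst d))) (at x)"
    by (auto intro!: derivative_eq_intros bounded_linear.has_derivative[OF blinfun.bounded_linear_right])
  from has_derivative_inner[OF this has_derivative_snd[OF has_derivative_ident]]
  show ?thesis by (simp add: plus_blinfun.rep_eq inner_commute add.commute)
qed

text \<open>
  The equation in terms of the total potential \<open>\<phi>\<close> only. The curve has two derivatives, \<open>u'\<close> in \<open>V\<close> and \<open>p\<close>
  in \<open>H\<close>; they agree almost everywhere after applying \<open>J\<close>, but only \<open>p\<close> is known to be continuous.
\<close>

locale evolution =
  fixes J :: "'v::real_inner \<Rightarrow>\<^sub>L 'h::real_inner" and \<gamma> :: "real \<Rightarrow> real"
    and \<phi> :: "'v \<Rightarrow> real" and \<phi>' :: "'v \<Rightarrow> 'v \<Rightarrow>\<^sub>L real"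
    and u u' :: "real \<Rightarrow> 'v" and p p' :: "real \<Rightarrow> 'h"
  assumes \<phi>_deriv: "\<And>x. (\<phi> has_derivative \<phi>' x) (at x)"
    and \<phi>'_cont: "continuous_on UNIV \<phi>'"
    and u_deriv: "has_L1_loc_deriv u u'"
    and Ju_deriv: "has_L1_loc_deriv (\<lambda>t. J (u t)) p"
    and p_deriv: "has_L1_loc_deriv p p'"
    and \<gamma>_cont: "continuous_on {0..} \<gamma>"
    and equation: "AE t in lebesgue. t \<ge> 0 \<longrightarrow>
          dual_embedding J (p' t) + \<gamma> t *\<^sub>R dual_embedding J (p t) + \<phi>' (u t) = 0"
begin

lemma p_cont: "continuous_on {0..} p" and u_cont: "continuous_on {0..} u"
  using has_L1_loc_deriv_continuous p_deriv u_deriv by blast+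

lemma velocity: "AE t in lebesgue. t \<ge> 0 \<longrightarrow> J (u' t) = p t"
  by (rule has_L1_loc_deriv_blinfun_unique[OF u_deriv Ju_deriv])

lemma pair_deriv: "has_L1_loc_deriv (\<lambda>t. (u t, p t)) (\<lambda>t. (u' t, p' t))"
  by (rule has_L1_loc_deriv_Pair[OF u_deriv p_deriv])

lemma equation_tested:
  "AE t in lebesgue. t \<ge> 0 \<longrightarrow> (\<forall>w. inner (p' t) (J w) + \<gamma> t * inner (p t) (J w) + \<phi>' (u t) w = 0)"
  using equation
proof eventually_elim
  case (elim t)
  show ?case
  proof (intro impI allI)
    fix w assume "t \<ge> 0"
    with elim have "blinfun_apply (dual_embedding J (p' t) + \<gamma> t *\<^sub>R dual_embedding J (p t) + \<phi>' (u t)) w = 0"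
      by simp
    then show "inner (p' t) (J w) + \<gamma> t * inner (p t) (J w) + \<phi>' (u t) w = 0"
      by (simp add: plus_blinfun.rep_eq scaleR_blinfun.rep_eq)
  qed
qed

text \<open>
  Test the equation with the velocity. The chain rule gives the derivative of the energy almost everywhere;
  as it equals the continuous function \<open>- \<gamma> |p|\<^sup>2\<close> there, the energy is continuously differentiable.
\<close>

lemma energy_DERIV:
  assumes t: "t > 0"
  shows "((\<lambda>t. 1/2 * (norm (p t))\<^sup>2 + \<phi> (u t)) has_real_derivative - \<gamma> t * (norm (p t))\<^sup>2) (at t)"
proof (rule has_integral_imp_DERIV[OF _ _ t])
  show "continuous_on {0..} (\<lambda>t. - \<gamma> t * (norm (p t))\<^sup>2)"
    by (intro continuous_intros \<gamma>_cont p_cont)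
  fix t :: real assume t: "t \<ge> 0"
  let ?\<Phi>' = "\<lambda>x::'v \<times> 'h. (blinfun_inner_right (snd x) o\<^sub>L snd_blinfun) + (\<phi>' (fst x) o\<^sub>L fst_blinfun)"
  have "continuous_on UNIV (\<lambda>x::'v \<times> 'h. \<phi>' (fst x))"
    by (rule continuous_on_compose2[OF \<phi>'_cont]) (auto intro: continuous_intros)
  then have "continuous_on UNIV ?\<Phi>'" by (intro continuous_intros)
  from has_L1_loc_deriv_chain[OF pair_deriv has_derivative_kinetic_plus_potential[OF \<phi>_deriv] this order_refl t]
  have "((\<lambda>r. inner (p r) (p' r) + \<phi>' (u r) (u' r)) has_integral
      (1/2 * (norm (p t))\<^sup>2 + \<phi> (u t)) - (1/2 * (norm (p 0))\<^sup>2 + \<phi> (u 0))) {0..t}"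
    by (simp add: plus_blinfun.rep_eq)
  then show "((\<lambda>t. - \<gamma> t * (norm (p t))\<^sup>2) has_integral
      (1/2 * (norm (p t))\<^sup>2 + \<phi> (u t)) - (1/2 * (norm (p 0))\<^sup>2 + \<phi> (u 0))) {0..t}"
  proof (rule has_integral_cong_AE_lebesgue)
    show "AE r in lebesgue. r \<in> {0..t} \<longrightarrow> - \<gamma> r * (norm (p r))\<^sup>2 = inner (p r) (p' r) + \<phi>' (u r) (u' r)"
      using equation_tested velocity
    proof eventually_elim
      case (elim r)
      show ?case
      proof
        assume "r \<in> {0..t}"
        then have v: "J (u' r) = p r" and
          w: "\<forall>w. inner (p' r) (J w) + \<gamma> r * inner (p r) (J w) + \<phi>' (u r) w = 0"
          using elim by simp_all
        from w[rule_format, of "u' r"] show "- \<gamma> r * (norm (p r))\<^sup>2 = inner (p r) (p' r) + \<phi>' (u r) (u' r)"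
          unfolding v power2_norm_eq_inner by (simp add: inner_commute)
      qed
    qed
  qed
qed

lemma half_square_dist_DERIV:
  assumes t: "t > 0"
  shows "((\<lambda>t. 1/2 * (norm (J (u t) - z))\<^sup>2) has_real_derivative inner (J (u t) - z) (p t)) (at t)"
proof -
  have "((\<lambda>t. J (u t)) has_vector_derivative p t) (at t)"
    by (rule has_L1_loc_deriv_has_vector_derivative[OF Ju_deriv p_cont t])
  from has_derivative_diff[OF this[unfolded has_vector_derivative_def] has_derivative_const[of z]]
  have d: "((\<lambda>t. J (u t) - z) has_derivative (\<lambda>s. s *\<^sub>R p t)) (at t)" by simp
  have "((\<lambda>t. 1/2 * inner (J (u t) - z) (J (u t) - z)) has_derivative
      (\<lambda>s. inner (J (u t) - z) (p t) * s)) (at t)"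
    by (rule has_derivative_eq_rhs[OF has_derivative_mult_right[OF has_derivative_inner[OF d d]]])
      (auto simp: inner_commute)
  then show ?thesis by (simp add: has_field_derivative_def power2_norm_eq_inner)
qed

lemma radial_rate_cont:
  "continuous_on {0..} (\<lambda>r. (norm (p r))\<^sup>2 - \<gamma> r * inner (J (u r) - J z) (p r) - (\<phi> (u r) - \<phi> z))"
proof -
  have "continuous_on {0..} (\<lambda>r. \<phi> (u r))"
    by (rule continuous_on_compose2[OF _ u_cont, of UNIV])
      (auto intro!: continuous_at_imp_continuous_on has_derivative_continuous[OF \<phi>_deriv])
  then show ?thesis by (intro continuous_intros \<gamma>_cont p_cont u_cont)
qed

text \<open>
  Test the equation with \<open>u - z\<close>. Only an inequality results, because convexity bounds \<open>\<phi>' (u) (u - z)\<close> from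
  below by \<open>\<phi> u - \<phi> z\<close>.
\<close>

lemma radial_velocity_increment:
  assumes grad: "\<And>x. \<phi> x + \<phi>' x (z - x) \<le> \<phi> z" and st: "0 \<le> s" "s \<le> t"
  defines "k \<equiv> \<lambda>t. inner (J (u t) - J z) (p t)"
  shows "k t - k s \<le> integral {s..t} (\<lambda>r. (norm (p r))\<^sup>2 - \<gamma> r * k r - (\<phi> (u r) - \<phi> z))"
proof -
  let ?\<Phi>' = "\<lambda>x::'v \<times> 'h. (blinfun_inner_right (snd x) o\<^sub>L (J o\<^sub>L fst_blinfun)) + (blinfun_inner_right (J (fst x) - J z) o\<^sub>L snd_blinfun)"
  have "continuous_on UNIV ?\<Phi>'" by (intro continuous_intros)
  from has_L1_loc_deriv_chain[OF pair_deriv has_derivative_inner_affine this st]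
  have i: "((\<lambda>r. inner (p r) (J (u' r)) + inner (J (u r) - J z) (p' r)) has_integral k t - k s) {s..t}"
    by (simp add: plus_blinfun.rep_eq k_def)
  have "continuous_on {0..} (\<lambda>r. (norm (p r))\<^sup>2 - \<gamma> r * k r - (\<phi> (u r) - \<phi> z))"
    unfolding k_def by (rule radial_rate_cont)
  then have "(\<lambda>r. (norm (p r))\<^sup>2 - \<gamma> r * k r - (\<phi> (u r) - \<phi> z)) integrable_on {s..t}"
    by (intro integrable_continuous_real) (rule continuous_on_subset, use st in auto)
  from i integrable_integral[OF this] show ?thesis
  proof (rule has_integral_le_AE_lebesgue)
    show "AE r in lebesgue. r \<in> {s..t} \<longrightarrow>
        inner (p r) (J (u' r)) + inner (J (u r) - J z) (p' r)
        \<le> (norm (p r))\<^sup>2 - \<gamma> r * k r - (\<phi> (u r) - \<phi> z)"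
      using equation_tested velocity
    proof eventually_elim
      case (elim r)
      show ?case
      proof
        assume "r \<in> {s..t}"
        then have v: "J (u' r) = p r"
          and w: "\<forall>w. inner (p' r) (J w) + \<gamma> r * inner (p r) (J w) + \<phi>' (u r) w = 0"
          using elim st by simp_all
        note w[rule_format, of "u r - z"]
        moreover have "\<phi> (u r) - \<phi> z \<le> \<phi>' (u r) (u r - z)"
          using grad[of "u r"] by (simp add: blinfun.diff_right)
        ultimately show "inner (p r) (J (u' r)) + inner (J (u r) - J z) (p' r)
            \<le> (norm (p r))\<^sup>2 - \<gamma> r * k r - (\<phi> (u r) - \<phi> z)"
          unfolding k_def v power2_norm_eq_inner
          by (simp add: blinfun.diff_right inner_commute)
      qed
    qed
  qed
qed

lemma radial_velocity_slope:
  assumes grad: "\<And>x. \<phi> x + \<phi>' x (z - x) \<le> \<phi> z" and t: "t > 0"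
  shows "slope_le (\<lambda>t. inner (J (u t) - J z) (p t))
    ((norm (p t))\<^sup>2 - \<gamma> t * inner (J (u t) - J z) (p t) - (\<phi> (u t) - \<phi> z)) t"
  by (rule slope_le_integral[OF radial_rate_cont radial_velocity_increment[OF grad] t])

end

section \<open>Weak convergence and decay\<close>

theorem theorem1p2:
  fixes J :: "'v::{real_inner, complete_space} \<Rightarrow>\<^sub>L 'h::{real_inner, complete_space}"
    and \<gamma> :: "real \<Rightarrow> real"
    and A :: "'v \<Rightarrow>\<^sub>L ('v \<Rightarrow>\<^sub>L real)"
    and f :: "'v \<Rightarrow> ('v \<Rightarrow>\<^sub>L real)"
    and F \<phi> :: "'v \<Rightarrow> real"
    and a :: "'v \<Rightarrow> 'v \<Rightarrow> real"
    and \<alpha> K :: real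
    and u :: "real \<Rightarrow> 'v"
  assumes triple: "gelfand_triple J"
    and \<gamma>_nonneg: "\<forall>t\<ge>0. \<gamma> t \<ge> 0"
    and \<gamma>_decreasing: "antimono_on {0..} \<gamma>"
    and \<gamma>_W11: "W11_loc \<gamma>"
    and a_def: "a = (\<lambda>v w. blinfun_apply (blinfun_apply A v) w)"
    and a_sym: "\<forall>v w. a v w = a w v"
    and a_pos: "\<forall>v. a v v \<ge> 0"
    and a_coercive: "\<exists>\<kappa>\<ge>0. \<exists>\<mu>>0. \<forall>v.
          a v v + \<kappa> * (norm (blinfun_apply J v))\<^sup>2 \<ge> \<mu> * (norm v)\<^sup>2"
    and f_cont: "continuous_on UNIV f"
    and F_convex: "convex_on UNIV F"
    and F_deriv: "\<forall>v. (F has_derivative blinfun_apply (f v)) (at v)"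
    and \<phi>_def: "\<phi> = (\<lambda>v. 1/2 * a v v + F v)"
    and \<phi>_bdd: "bdd_below (range \<phi>)"
    and \<phi>_argmin: "minimizers \<phi> \<noteq> {}"
    and \<alpha>_range: "\<alpha> \<in> {0..1/2}"
    and K_pos: "K > 0"
    and \<gamma>_lower: "\<forall>t\<ge>0. \<gamma> t \<ge> K / (1 + t) powr \<alpha>"
    and sol: "evolution_solution J \<gamma> A f u"
  shows "(\<exists>u_inf \<in> minimizers \<phi>. weakly_tendsto u u_inf at_top) \<and>
    (\<lambda>t. 1/2 * (norm (vector_derivative (\<lambda>s. blinfun_apply J (u s)) (at t)))\<^sup>2
           + \<phi> (u t) - (INF v. \<phi> v)) \<in> o[at_top](\<lambda>t. 1 / t)"
proof -
  define \<phi>' where "\<phi>' v = blinfun_apply A v + f v" for v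
  obtain u' where u': "has_L1_loc_deriv u u'"
    using sol unfolding evolution_solution_def W11_loc_def by blast
  obtain p p' where p: "has_L1_loc_deriv (\<lambda>t. J (u t)) p" and p': "has_L1_loc_deriv p p'"
    and eq: "AE t in lebesgue. t \<ge> 0 \<longrightarrow>
        dual_embedding J (p' t) + \<gamma> t *\<^sub>R dual_embedding J (p t) + blinfun_apply A (u t) + f (u t) = 0"
    using sol unfolding evolution_solution_def by blast
  obtain \<gamma>' where "has_L1_loc_deriv \<gamma> \<gamma>'" using \<gamma>_W11 unfolding W11_loc_def by blast
  then have \<gamma>_cont: "continuous_on {0..} \<gamma>" by (rule has_L1_loc_deriv_continuous)
  have \<phi>_deriv: "(\<phi> has_derivative \<phi>' v) (at v)" for v
  proof -
    have "((\<lambda>v. A v v) has_derivative (\<lambda>h. A v h + A h v)) (at v)"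
      by (rule bounded_bilinear.FDERIV[OF bounded_bilinear_blinfun_apply
            bounded_linear.has_derivative[OF blinfun.bounded_linear_right has_derivative_ident] has_derivative_ident])
    moreover have "A h v = A v h" for h using a_sym by (simp add: a_def)
    ultimately have "((\<lambda>v. A v v) has_derivative (\<lambda>h. 2 * A v h)) (at v)" by simp
    from has_derivative_add[OF has_derivative_mult_right[OF this, of "1/2"] F_deriv[rule_format]]
    show ?thesis by (simp add: \<phi>_def a_def \<phi>'_def plus_blinfun.rep_eq)
  qed
  have \<phi>'_cont: "continuous_on UNIV \<phi>'"
    unfolding \<phi>'_def by (intro continuous_intros f_cont)
  \<comment> \<open>The quadratic part contributes its remainder exactly; at a minimiser \<open>v\<close> this bounds
    \<open>a (w - v) (w - v)\<close> by twice the excess of \<open>\<phi> w\<close> over the minimum.\<close>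
  have gradient: "\<phi> v + \<phi>' v (w - v) + 1/2 * a (w - v) (w - v) \<le> \<phi> w" for v w
  proof -
    have "F v + f v (w - v) \<le> F w"
      by (rule convex_on_gradient_inequality[OF F_convex]) (use F_deriv in blast)
    moreover have "A w v = A v w" using a_sym by (simp add: a_def)
    ultimately show ?thesis
      unfolding \<phi>_def \<phi>'_def a_def
      by (simp add: plus_blinfun.rep_eq blinfun.diff_left blinfun.diff_right field_simps)
  qed
  have min_iff: "z \<in> minimizers \<phi> \<longleftrightarrow> (\<forall>v. \<phi> z \<le> \<phi> v)" for z
    by (simp add: minimizers_def is_arg_min_linorder)
  obtain z\<^sub>0 where z\<^sub>0: "\<And>v. \<phi> z\<^sub>0 \<le> \<phi> v" using \<phi>_argmin min_iff by blast
  define m where "m = \<phi> z\<^sub>0"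
  have INF_m: "(INF v. \<phi> v) = m" unfolding m_def by (rule cInf_eq_minimum) (use z\<^sub>0 in auto)
  have min_m: "\<phi> z = m" if "z \<in> minimizers \<phi>" for z
    using that z\<^sub>0 min_iff unfolding m_def by (meson antisym)
  interpret evolution J \<gamma> \<phi> \<phi>' u u' p p'
    by unfold_locales (use \<phi>_deriv \<phi>'_cont u' p p' \<gamma>_cont eq in \<open>simp_all add: \<phi>'_def add.assoc\<close>)
  define E where "E t = 1/2 * (norm (p t))\<^sup>2 + \<phi> (u t) - m" for t
  have \<phi>_le_E: "\<phi> (u t) - m \<le> E t" for t by (simp add: E_def)
  define h where "h z t = 1/2 * (norm (J (u t) - J z))\<^sup>2" for z t
  have \<gamma>_ge: "K / sqrt (1 + t) \<le> \<gamma> t" if t: "t \<ge> 0" for t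
  proof -
    have "(1 + t) powr \<alpha> \<le> (1 + t) powr (1/2)" using \<alpha>_range t by (intro powr_mono) auto
    also have "\<dots> = sqrt (1 + t)" using t by (simp add: powr_half_sqrt)
    finally have "K / sqrt (1 + t) \<le> K / (1 + t) powr \<alpha>" using K_pos t by (intro divide_left_mono) auto
    also have "\<dots> \<le> \<gamma> t" using \<gamma>_lower t by blast
    finally show ?thesis .
  qed
  have dyn: "scalar_dynamics K \<gamma> E (\<lambda>t. (norm (p t))\<^sup>2) (h z) (\<lambda>t. inner (J (u t) - J z) (p t))"
    if z: "z \<in> minimizers \<phi>" for z
  proof
    show "K > 0" by (rule K_pos)
    show "continuous_on {0..} \<gamma>" by (rule \<gamma>_cont)
    show "\<gamma> t \<le> \<gamma> s" if "0 \<le> s" "s \<le> t" for s t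
      using monotone_onD[OF \<gamma>_decreasing, of s t] that by simp
    show "K / sqrt (1 + t) \<le> \<gamma> t" if "t \<ge> 0" for t by (rule \<gamma>_ge[OF that])
    fix t :: real assume t: "t > 0"
    show "0 \<le> E t" using z\<^sub>0[of "u t"] by (simp add: E_def m_def add_increasing)
    show "(norm (p t))\<^sup>2 \<le> 2 * E t" using z\<^sub>0[of "u t"] by (simp add: E_def m_def)
    show "0 \<le> (norm (p t))\<^sup>2" "0 \<le> h z t" by (simp_all add: h_def)
    show "(E has_real_derivative - \<gamma> t * (norm (p t))\<^sup>2) (at t)"
      unfolding E_def using DERIV_diff[OF energy_DERIV[OF t] DERIV_const[of m]] by simp
    show "(h z has_real_derivative inner (J (u t) - J z) (p t)) (at t)"
      unfolding h_def by (rule half_square_dist_DERIV[OF t])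
    have "(inner (J (u t) - J z) (p t))\<^sup>2 \<le> (norm (J (u t) - J z) * norm (p t))\<^sup>2"
      using Cauchy_Schwarz_ineq2 by (metis abs_le_square_iff abs_mult abs_norm_cancel)
    then show "(inner (J (u t) - J z) (p t))\<^sup>2 \<le> 2 * h z t * (norm (p t))\<^sup>2"
      by (simp add: h_def power_mult_distrib)
    have "continuous_on {0..} (\<lambda>t. inner (J (u t) - J z) (p t))"
      by (intro continuous_intros u_cont p_cont)
    then show "isCont (\<lambda>t. inner (J (u t) - J z) (p t)) t"
      by (rule continuous_on_interior) (use t in simp)
    have grad: "\<phi> x + \<phi>' x (z - x) \<le> \<phi> z" for x
      using gradient[of x z] a_pos[rule_format, of "z - x"] by simp
    have "(norm (p t))\<^sup>2 - \<gamma> t * inner (J (u t) - J z) (p t) - (\<phi> (u t) - \<phi> z)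
        = 3/2 * (norm (p t))\<^sup>2 - \<gamma> t * inner (J (u t) - J z) (p t) - E t"
      using min_m[OF z] by (simp add: E_def)
    then show "slope_le (\<lambda>t. inner (J (u t) - J z) (p t))
        (3/2 * (norm (p t))\<^sup>2 - \<gamma> t * inner (J (u t) - J z) (p t) - E t) t"
      using radial_velocity_slope[OF grad t] by (simp only:)
  qed
  have z\<^sub>0_min: "z\<^sub>0 \<in> minimizers \<phi>" using z\<^sub>0 min_iff by blast
  interpret z\<^sub>0: scalar_dynamics K \<gamma> E "\<lambda>t. (norm (p t))\<^sup>2" "h z\<^sub>0" "\<lambda>t. inner (J (u t) - J z\<^sub>0) (p t)"
    by (rule dyn[OF z\<^sub>0_min])
  have tE: "((\<lambda>t. t * E t) \<longlongrightarrow> 0) at_top" by (rule z\<^sub>0.energy_decay)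
  have h_conv: "\<exists>l. (h z \<longlongrightarrow> l) at_top" if "z \<in> minimizers \<phi>" for z
    by (rule scalar_dynamics.h_converges[OF dyn[OF that]])
  have "((\<lambda>t. t * E t * inverse t) \<longlongrightarrow> 0 * 0) at_top"
    by (intro tendsto_mult tE tendsto_inverse_0_at_top filterlim_ident)
  then have E_lim: "(E \<longlongrightarrow> 0) at_top"
    unfolding mult_zero_left
    by (rule Lim_transform_eventually, intro eventually_mono[OF eventually_gt_at_top[of 0]]) simp

  have bounded: "\<exists>B. \<forall>\<^sub>F t in at_top. norm (u t) \<le> B"
  proof -
    obtain \<kappa> \<mu> where \<kappa>: "\<kappa> \<ge> 0" and \<mu>: "\<mu> > 0"
      and coercive: "\<And>v. \<mu> * (norm v)\<^sup>2 \<le> a v v + \<kappa> * (norm (J v))\<^sup>2"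
      using a_coercive by blast
    have "\<phi>' z\<^sub>0 = 0"
      using differential_zero_maxmin[OF UNIV_I open_UNIV \<phi>_deriv[of z\<^sub>0]] z\<^sub>0
      by (intro blinfun_eqI) auto
    then have a_le: "a (u t - z\<^sub>0) (u t - z\<^sub>0) \<le> 2 * E t" for t
      using gradient[of z\<^sub>0 "u t"] \<phi>_le_E[of t] by (simp add: m_def)
    obtain l where l: "(h z\<^sub>0 \<longlongrightarrow> l) at_top" using h_conv[OF z\<^sub>0_min] by blast
    have "\<forall>\<^sub>F t in at_top. E t < 1" "\<forall>\<^sub>F t in at_top. h z\<^sub>0 t < l + 1"
      by (rule order_tendstoD(2)[OF E_lim], simp, rule order_tendstoD(2)[OF l], simp)
    then have "\<forall>\<^sub>F t in at_top. norm (u t) \<le> norm z\<^sub>0 + sqrt ((2 + \<kappa> * (2 * (l + 1))) / \<mu>)"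
    proof eventually_elim
      case (elim t)
      have "\<kappa> * (norm (J (u t - z\<^sub>0)))\<^sup>2 = \<kappa> * (2 * h z\<^sub>0 t)" by (simp add: h_def blinfun.diff_right)
      also have "\<dots> \<le> \<kappa> * (2 * (l + 1))" using elim \<kappa> by (intro mult_left_mono) auto
      finally have "\<mu> * (norm (u t - z\<^sub>0))\<^sup>2 \<le> 2 + \<kappa> * (2 * (l + 1))"
        using coercive[of "u t - z\<^sub>0"] a_le[of t] elim by linarith
      then have "(norm (u t - z\<^sub>0))\<^sup>2 \<le> (2 + \<kappa> * (2 * (l + 1))) / \<mu>"
        using \<mu> by (simp add: field_simps)
      then have "norm (u t - z\<^sub>0) \<le> sqrt ((2 + \<kappa> * (2 * (l + 1))) / \<mu>)" by (rule real_le_rsqrt)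
      then show ?case using norm_triangle_sub[of "u t" "z\<^sub>0"] by linarith
    qed
    then show ?thesis by blast
  qed
  then obtain B where B: "\<forall>\<^sub>F t in at_top. norm (u t) \<le> B" by blast

  let ?Z = "weak_hull_at_top (\<lambda>_. True) u"
  \<comment> \<open>The tangent of \<open>\<phi>\<close> at \<open>x\<close> lies below \<open>\<phi>\<close>, so a half-space given by \<open>\<phi>' x\<close> contains all \<open>u t\<close> with
    \<open>E t < e\<close>, and it contains \<open>x\<close> only if \<open>\<phi> x \<le> m + e\<close>.\<close>
  have Z_min: "x \<in> minimizers \<phi>" if x: "x \<in> ?Z" for x
  proof -
    have "\<phi> x \<le> m + e" if e: "e > 0" for e
    proof -
      have "\<forall>\<^sub>F t in at_top. E t < e" using e by (intro order_tendstoD(2)[OF E_lim])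
      then have "\<forall>\<^sub>F t in at_top. True \<longrightarrow> \<phi>' x (u t) \<le> m + e - \<phi> x + \<phi>' x x"
      proof eventually_elim
        case (elim t)
        then show ?case
          using gradient[of x "u t"] a_pos[rule_format, of "u t - x"] \<phi>_le_E[of t]
          by (simp add: blinfun.diff_right)
      qed
      from weak_hull_at_topD[OF x this] show ?thesis by simp
    qed
    then have "\<phi> x \<le> m" by (rule field_le_epsilon)
    then show ?thesis using z\<^sub>0 min_iff unfolding m_def by (meson order_trans)
  qed
  \<comment> \<open>Opial's argument: the pairing of \<open>J (u t)\<close> with \<open>J (y - x)\<close> is a difference of squared distances up to a
    constant, hence convergent, so its value at a point of the hull does not depend on the point.\<close>
  have Z_unique: "x = y" if x: "x \<in> ?Z" and y: "y \<in> ?Z" for x y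
  proof -
    obtain l\<^sub>x l\<^sub>y where l: "(h x \<longlongrightarrow> l\<^sub>x) at_top" "(h y \<longlongrightarrow> l\<^sub>y) at_top"
      using h_conv[OF Z_min[OF x]] h_conv[OF Z_min[OF y]] by blast
    define c where "c = 1/2 * (inner (J y) (J y) - inner (J x) (J x))"
    have "dual_embedding J (J (y - x)) (u t) = h x t - h y t + c" for t
      by (simp add: h_def c_def power2_norm_eq_inner blinfun.diff_right inner_diff_left inner_diff_right
          inner_commute field_simps)
    then have lim: "((\<lambda>t. dual_embedding J (J (y - x)) (u t)) \<longlongrightarrow> l\<^sub>x - l\<^sub>y + c) at_top"
      by (simp only:) (intro tendsto_intros l)
    have "dual_embedding J (J (y - x)) y = dual_embedding J (J (y - x)) x"
      using weak_hull_at_top_limit[OF x lim] weak_hull_at_top_limit[OF y lim] by simp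
    then have "inner (J (y - x)) (J (y - x)) = 0" by (simp add: blinfun.diff_right inner_diff_right)
    then have "J y = J x" by (simp add: blinfun.diff_right)
    then show "x = y" using triple unfolding gelfand_triple_def by (simp add: inj_eq)
  qed
  have "\<exists>\<^sub>F t::real in at_top. True" by (simp add: frequently_const)
  from weak_hull_at_top_nonempty[OF B this] obtain x where x: "x \<in> ?Z" by blast
  have "weakly_tendsto u x at_top"
    by (rule weakly_tendsto_if_weak_hull_subset_singleton[OF B]) (use Z_unique x in blast)
  moreover have "(\<lambda>t. 1/2 * (norm (vector_derivative (\<lambda>s. J (u s)) (at t)))\<^sup>2 + \<phi> (u t) - (INF v. \<phi> v))
      \<in> o[at_top](\<lambda>t. 1 / t)"
  proof (rule smalloI_tendsto)
    have "\<forall>\<^sub>F t in at_top. t * E t = (1/2 * (norm (vector_derivative (\<lambda>s. J (u s)) (at t)))\<^sup>2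
        + \<phi> (u t) - (INF v. \<phi> v)) / (1 / t)"
      using eventually_gt_at_top[of 0]
    proof eventually_elim
      case (elim t)
      have "vector_derivative (\<lambda>s. J (u s)) (at t) = p t"
        by (rule vector_derivative_at, rule has_L1_loc_deriv_has_vector_derivative[OF p p_cont elim])
      then show ?case by (simp add: E_def INF_m)
    qed
    from Lim_transform_eventually[OF tE this]
    show "((\<lambda>t. (1/2 * (norm (vector_derivative (\<lambda>s. J (u s)) (at t)))\<^sup>2
        + \<phi> (u t) - (INF v. \<phi> v)) / (1 / t)) \<longlongrightarrow> 0) at_top" .
    show "\<forall>\<^sub>F t in at_top. 1 / t \<noteq> (0::real)"
      using eventually_gt_at_top[of 0] by eventually_elim simp
  qed
  ultimately show ?thesis using Z_min[OF x] by blast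
qed

end
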